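(* Let $k\geq t+2\geq 4$, $n\geq 7(k-t+1)k^2$ and let $d\geq 2$ be an integer. If $\mathcal{F}\subseteq\binom{[n]}{k}$ is a $t$-intersecting family with $$|\mathcal{F}|\geq\binom{n-t}{k-t}-\binom{n-t-d}{k-t}+t\binom{n-t-d}{k-t-d+1},$$ then either $\gamma_t(\mathcal{F})\leq t\binom{n-t-d}{k-t-d+1}$, that is, there exists a $t$-subset $X$ of $[n]$ such that $|\mathcal{F}\setminus\mathcal{F}[X]|\leq t\binom{n-t-d}{k-t-d+1}$, or $d\leq t+2$ and $\mathcal{F}\subseteq\mathcal{A}(Z)$ for some $Z\in\binom{[n]}{t+2}$. Moreover, if $2\leq d\leq k-t+1$, then in the former case, equality $\gamma_t(\mathcal{F})=t\binom{n-t-d}{k-t-d+1}$ holds if and only if $\mathcal{F}\cong\mathcal{L}(n,k,t,d,d)$.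
   Context: $n,k,t$ are positive integers, $[n]=\{1,\dots,n\}$, and $\binom{[n]}{k}$ is the family of all $k$-subsets of $[n]$. Binomial coefficients $\binom{a}{b}$ are $0$ when $b<0$ or $a<b$. A family $\mathcal{F}$ is $t$-intersecting if $|F\cap F'|\ge t$ for all $F,F'\in\mathcal{F}$. $\mathcal{F}[X]=\{F\in\mathcal{F}:X\subseteq F\}$; $\Delta_t(\mathcal{F})=\max\{|\mathcal{F}[S]|:S\in\binom{[n]}{t}\}$, and the $t$-diversity is $\gamma_t(\mathcal{F}):=|\mathcal{F}|-\Delta_t(\mathcal{F})$. Two families are isomorphic ($\cong$) if they are the same up to a permutation of $[n]$. For $Z\in\binom{[n]}{t+2}$, $\mathcal{A}(Z)=\{F\in\binom{[n]}{k}:|F\cap Z|\geq t+1\}$. For $X\in\binom{[n]}{t}$, $U\in\binom{[n]}{t+u}$ and $V\in\binom{[n]}{t+v}$ with $X\subseteq U\cap V$, $$\mathcal{L}(X,U,V)=\left\{F\in\binom{[n]}{k}:X\subseteq F,\ F\cap(V\setminus X)\neq\emptyset\right\}\cup\left\{F\in\binom{[n]}{k}:F\cap U=U\setminus\{x\}\text{ for some }x\in X\right\},$$ and $\mathcal{L}(n,k,t,u,v)=\mathcal{L}([t],[t+u],[t+v])$. *)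

theory Defs
  imports "HOL-Library.Ramsey" "HOL-Combinatorics.Permutations"
begin

text \<open>
  The ground set \<open>[n]\<close> is \<open>{1..n}\<close>, and the family of its \<open>k\<close>-subsets
  is \<open>nsets {1..n} k\<close>.
\<close>

text \<open>
  The binomial coefficient with integer arguments, equal to 0 for \<open>b < 0\<close> or \<open>a < b\<close>
  (the entries \<open>n - t - d\<close> and \<open>k - t - d + 1\<close> may be negative, where truncated
  subtraction on the naturals would give the wrong value, e.g. \<open>n choose 0 = 1\<close>).
\<close>

definition int_binom :: "int \<Rightarrow> int \<Rightarrow> nat" where
  "int_binom a b = (if b < 0 \<or> a < b then 0 else nat a choose nat b)"

definition t_intersecting :: "nat \<Rightarrow> nat set set \<Rightarrow> bool" where
  "t_intersecting t \<F> \<longleftrightarrow> (\<forall>F\<in>\<F>. \<forall>F'\<in>\<F>. t \<le> card (F \<inter> F'))"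

definition containing :: "nat set set \<Rightarrow> nat set \<Rightarrow> nat set set" where
  "containing \<F> X = {F \<in> \<F>. X \<subseteq> F}"

text \<open>
  The maximum is over a finite set, which is nonempty exactly when \<open>t \<le> n\<close>.
\<close>

definition max_degree :: "nat \<Rightarrow> nat \<Rightarrow> nat set set \<Rightarrow> nat" where
  "max_degree n t \<F> = Max ((\<lambda>S. card (containing \<F> S)) ` nsets {1..n} t)"

text \<open>
  For \<open>t \<le> n\<close> and a finite family, \<open>max_degree n t \<F> \<le> card \<F>\<close>, so the subtraction
  does not truncate.
\<close>

definition diversity :: "nat \<Rightarrow> nat \<Rightarrow> nat set set \<Rightarrow> nat" where
  "diversity n t \<F> = card \<F> - max_degree n t \<F>"

definition isomorphic :: "nat \<Rightarrow> nat set set \<Rightarrow> nat set set \<Rightarrow> bool" where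
  "isomorphic n \<F> \<G> \<longleftrightarrow> (\<exists>\<pi>. \<pi> permutes {1..n} \<and> \<G> = (\<lambda>F. \<pi> ` F) ` \<F>)"

definition family_A :: "nat \<Rightarrow> nat \<Rightarrow> nat \<Rightarrow> nat set \<Rightarrow> nat set set" where
  "family_A n k t Z = {F \<in> nsets {1..n} k. card (F \<inter> Z) \<ge> t + 1}"

definition family_L :: "nat \<Rightarrow> nat \<Rightarrow> nat set \<Rightarrow> nat set \<Rightarrow> nat set \<Rightarrow> nat set set" where
  "family_L n k X U V =
     {F \<in> nsets {1..n} k. X \<subseteq> F \<and> F \<inter> (V - X) \<noteq> {}} \<union>
     {F \<in> nsets {1..n} k. \<exists>x\<in>X. F \<inter> U = U - {x}}"

definition canonical_L :: "nat \<Rightarrow> nat \<Rightarrow> nat \<Rightarrow> nat \<Rightarrow> nat \<Rightarrow> nat set set" where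
  "canonical_L n k t u v = family_L n k {1..t} {1..t+u} {1..t+v}"

end

theory Submission
  imports Defs Complex_Main
begin

text \<open>
  Peeling off the large minimal members of \<open>t\<close>-intersecting families of sets of size at most
  \<open>s\<close>, for \<open>s = k, k - 1, \<dots>, t + 2\<close>, yields a \<open>t\<close>-intersecting family \<open>\<G>\<close> of sets of size at most
  \<open>t + 1\<close> such that all but at most \<open>(81/16) k (k - 1) C2\<close> members of \<open>\<F>\<close> contain a member of \<open>\<G>\<close>,
  where \<open>C2 = (n - t - 2 choose k - t - 2)\<close>. Since \<open>7 k\<^sup>2 C2 \<le> C1 = (n - t - 1 choose k - t - 1)\<close>,
  this exceptional part is negligible against \<open>C1\<close>. Either all members of \<open>\<G>\<close> lie in a
  \<open>(t + 2)\<close>-set \<open>Z\<close>; then the size of \<open>\<F>\<close> forces three of them to be \<open>t\<close>-covers of \<open>\<F>\<close>, and three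
  covers inside \<open>Z\<close> force \<open>\<F> \<subseteq> \<A>(Z)\<close>. Or they share a \<open>t\<close>-set \<open>X\<close>; let \<open>V\<close> be the set of \<open>v\<close> such
  that \<open>X \<union> {v}\<close> is a \<open>t\<close>-cover. Only few members of \<open>\<F>[X]\<close> miss \<open>V\<close>, so the size of \<open>\<F>\<close> forces
  \<open>|V| \<ge> d\<close>, and a member of \<open>\<F>\<close> not containing \<open>X\<close> contains \<open>V\<close> and all of \<open>X\<close> but one point.
\<close>

section \<open>Counting and branching\<close>

lemma card_nsets_superset_disjoint:
  assumes A: "finite A" "P \<subseteq> A" "Q \<subseteq> A" "P \<inter> Q = {}" and k: "card P \<le> k"
  shows "card {F \<in> nsets A k. P \<subseteq> F \<and> F \<inter> Q = {}} = (card A - card P - card Q) choose (k - card P)"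
proof -
  have fin: "finite P" "finite Q" using A finite_subset by blast+
  have "bij_betw (\<lambda>G. G \<union> P) {G. G \<subseteq> A - P - Q \<and> card G = k - card P}
          {F \<in> nsets A k. P \<subseteq> F \<and> F \<inter> Q = {}}"
  proof (rule bij_betw_byWitness[where f' = "\<lambda>F. F - P"])
    show "(\<lambda>G. G \<union> P) ` {G. G \<subseteq> A - P - Q \<and> card G = k - card P}
          \<subseteq> {F \<in> nsets A k. P \<subseteq> F \<and> F \<inter> Q = {}}"
    proof clarify
      fix G assume G: "G \<subseteq> A - P - Q" "card G = k - card P"
      then have "finite G" using A(1) by (meson finite_Diff finite_subset)
      moreover have "card (G \<union> P) = k"
        using G fin \<open>finite G\<close> k by (subst card_Un_disjoint) auto
      ultimately show "G \<union> P \<in> nsets A k \<and> P \<subseteq> G \<union> P \<and> (G \<union> P) \<inter> Q = {}"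
        using G A fin unfolding nsets_def by auto
    qed
    show "(\<lambda>F. F - P) ` {F \<in> nsets A k. P \<subseteq> F \<and> F \<inter> Q = {}}
          \<subseteq> {G. G \<subseteq> A - P - Q \<and> card G = k - card P}"
      using fin by (auto simp: nsets_def card_Diff_subset)
  qed auto
  then have "card {F \<in> nsets A k. P \<subseteq> F \<and> F \<inter> Q = {}}
             = card {G. G \<subseteq> A - P - Q \<and> card G = k - card P}"
    by (simp add: bij_betw_same_card)
  also have "\<dots> = card (A - P - Q) choose (k - card P)"
    using A(1) by (simp add: n_subsets)
  also have "card (A - P - Q) = card A - card P - card Q"
    using A fin by (subst card_Diff_subset card_Diff_subset_Int; auto simp: card_Diff_subset)+
  finally show ?thesis .
qed

lemma card_nsets_superset:
  assumes "finite A" "P \<subseteq> A" "card P \<le> k"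
  shows "card {F \<in> nsets A k. P \<subseteq> F} = (card A - card P) choose (k - card P)"
  using card_nsets_superset_disjoint[of A P "{}" k] assms by simp

lemma card_nsets_superset_le:
  assumes "finite A" "P \<subseteq> A" "p \<le> card P" "p \<le> k"
  shows "card {F \<in> nsets A k. P \<subseteq> F} \<le> (card A - p) choose (k - p)"
proof -
  obtain P' where P': "P' \<subseteq> P" "card P' = p" using obtain_subset_with_card_n assms(3) by metis
  have "card {F \<in> nsets A k. P \<subseteq> F} \<le> card {F \<in> nsets A k. P' \<subseteq> F}"
    using P' assms(1) by (intro card_mono) (auto simp: finite_imp_finite_nsets)
  also have "\<dots> = (card A - p) choose (k - p)"
    using P' assms by (subst card_nsets_superset) auto
  finally show ?thesis .
qed

section \<open>Union bounds and branching on hitting sets\<close>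

lemma card_UN_le_mult:
  assumes "finite I" "\<And>i. i \<in> I \<Longrightarrow> card (f i) \<le> c"
  shows "card (\<Union>i\<in>I. f i) \<le> card I * c"
proof -
  have "card (\<Union>i\<in>I. f i) \<le> (\<Sum>i\<in>I. card (f i))" by (rule card_UN_le[OF assms(1)])
  also have "\<dots> \<le> card I * c" using assms(2) by (metis of_nat_id sum_bounded_above)
  finally show ?thesis .
qed

text \<open>Any subset \<open>Y\<close> of \<open>B'\<close> of this size leaves only t - 1 points
  of \<open>B'\<close>, so a set avoiding \<open>Y\<close> cannot meet \<open>B'\<close> in t
  points. Since \<open>S\<close> has fewer than t points in \<open>B'\<close>, there is room to
  choose \<open>Y\<close> outside \<open>S\<close>.\<close>

lemma hitting_set:
  assumes "finite B'" "card (S \<inter> B') < t" "t \<le> card B'"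
  obtains Y where "Y \<subseteq> B' - S" "finite Y" "card Y = card B' - t + 1"
    "\<And>B. t \<le> card (B \<inter> B') \<Longrightarrow> B \<inter> Y \<noteq> {}"
proof -
  have "card (B' - S) = card B' - card (S \<inter> B')"
    using assms(1) by (metis card_Diff_subset_Int finite_Int inf_commute)
  then have "card B' - t + 1 \<le> card (B' - S)" using assms by linarith
  then obtain Y where Y: "Y \<subseteq> B' - S" "card Y = card B' - t + 1" "finite Y"
    using obtain_subset_with_card_n by metis
  have "B \<inter> Y \<noteq> {}" if "t \<le> card (B \<inter> B')" for B
  proof
    assume "B \<inter> Y = {}"
    then have "B \<inter> B' \<subseteq> B' - Y" by blast
    then have "card (B \<inter> B') \<le> card (B' - Y)" using assms(1) by (simp add: card_mono)
    also have "\<dots> = card B' - card Y" using Y by (intro card_Diff_subset) auto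
    finally show False using that Y assms by linarith
  qed
  with Y show thesis using that by blast
qed

text \<open>One branching step: \<open>B'\<close> rejects \<open>S\<close> but meets every member in
  t points, so each member containing \<open>S\<close> contains one of at most
  \<open>s - t + 1\<close> further points. If \<open>B'\<close> has fewer than t points,
  \<open>\<W>\<close> is empty.\<close>

lemma card_containing_branch:
  assumes "finite \<W>" "finite B'" "card (S \<inter> B') < t" "card B' \<le> s"
    and "\<And>B. B \<in> \<W> \<Longrightarrow> t \<le> card (B \<inter> B')"
    and c: "\<And>y. y \<in> B' - S \<Longrightarrow> card (containing \<W> (insert y S)) \<le> c"
  shows "card (containing \<W> S) \<le> (s - t + 1) * c"
proof (cases "t \<le> card B'")
  case True
  obtain Y where Y: "Y \<subseteq> B' - S" "finite Y" "card Y = card B' - t + 1"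
    "\<And>B. t \<le> card (B \<inter> B') \<Longrightarrow> B \<inter> Y \<noteq> {}"
    using hitting_set[OF assms(2,3) True] by metis
  have "containing \<W> S \<subseteq> (\<Union>y\<in>Y. containing \<W> (insert y S))"
    using Y(4) assms(5) unfolding containing_def by fast
  then have "card (containing \<W> S) \<le> card (\<Union>y\<in>Y. containing \<W> (insert y S))"
    using assms(1) Y(2) by (intro card_mono) (auto simp: containing_def)
  also have "\<dots> \<le> card Y * c" using Y c by (intro card_UN_le_mult) auto
  also have "\<dots> \<le> (s - t + 1) * c" using Y(3) assms(4) by (intro mult_right_mono) auto
  finally show ?thesis .
next
  case False
  have "B \<notin> \<W>" for B
    using assms(5)[of B] False card_mono[OF assms(2), of "B \<inter> B'"] by auto
  then have "containing \<W> S = {}" by (auto simp: containing_def)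
  then show ?thesis by simp
qed

text \<open>Every member shares a t-subset with a fixed member, which gives
  \<open>s choose t\<close> starting sets. The assumption \<open>min\<close> then allows s - t
  branching steps, until the set has s points and can only be the member itself.\<close>

lemma card_minimal_members_le:
  assumes fin: "finite \<W>" and size: "\<And>B. B \<in> \<W> \<Longrightarrow> finite B \<and> card B = s"
    and int: "t_intersecting t \<W>"
    and min: "\<And>B S. B \<in> \<W> \<Longrightarrow> S \<subset> B \<Longrightarrow>
      \<exists>B'. finite B' \<and> card B' \<le> s \<and> card (S \<inter> B') < t \<and> (\<forall>B\<in>\<W>. t \<le> card (B \<inter> B'))"
  shows "card \<W> \<le> (s choose t) * (s - t + 1) ^ (s - t)"
proof -
  have branch: "card (containing \<W> S) \<le> (s - t + 1) ^ j" if "finite S" "card S + j = s" for S j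
    using that
  proof (induction j arbitrary: S)
    case 0
    have "containing \<W> S \<subseteq> {S}"
    proof
      fix B assume "B \<in> containing \<W> S"
      then have "S \<subseteq> B" "finite B" "card B = s" using size by (auto simp: containing_def)
      then show "B \<in> {S}" using 0 card_subset_eq[of B S] by simp
    qed
    then show ?case by (metis card_mono card.empty card_insert_disjoint empty_iff finite.emptyI
          finite.insertI power_0 One_nat_def)
  next
    case (Suc j)
    show ?case
    proof (cases "containing \<W> S = {}")
      case False
      then obtain B where B: "B \<in> \<W>" "S \<subseteq> B" by (auto simp: containing_def)
      then have "S \<subset> B" using size[of B] Suc.prems by auto
      from min[OF B(1) this] obtain B' where B': "finite B'" "card B' \<le> s" "card (S \<inter> B') < t"
        "\<forall>B\<in>\<W>. t \<le> card (B \<inter> B')" by blast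
      have "card (containing \<W> S) \<le> (s - t + 1) * (s - t + 1) ^ j"
      proof (rule card_containing_branch[OF fin B'(1,3,2)])
        show "card (containing \<W> (insert y S)) \<le> (s - t + 1) ^ j" if "y \<in> B' - S" for y
          using Suc.prems that by (intro Suc.IH) auto
      qed (use B' in auto)
      then show ?thesis by simp
    qed simp
  qed
  show ?thesis
  proof (cases "\<W> = {}")
    case False
    then obtain B0 where B0: "B0 \<in> \<W>" by blast
    let ?T = "{S. S \<subseteq> B0 \<and> card S = t}"
    have "finite ?T" using size[OF B0] by simp
    have ts: "t \<le> s" using int B0 size[OF B0] unfolding t_intersecting_def by fastforce
    have "\<W> \<subseteq> (\<Union>S\<in>?T. containing \<W> S)"
    proof
      fix B assume B: "B \<in> \<W>"
      then have "t \<le> card (B0 \<inter> B)" using int B0 unfolding t_intersecting_def by blast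
      then obtain S where "S \<subseteq> B0 \<inter> B" "card S = t" using obtain_subset_with_card_n by metis
      then show "B \<in> (\<Union>S\<in>?T. containing \<W> S)" using B by (auto simp: containing_def)
    qed
    then have "card \<W> \<le> card (\<Union>S\<in>?T. containing \<W> S)"
      using fin \<open>finite ?T\<close> by (intro card_mono) (auto simp: containing_def)
    also have "\<dots> \<le> card ?T * (s - t + 1) ^ (s - t)"
    proof (rule card_UN_le_mult[OF \<open>finite ?T\<close>])
      fix S assume "S \<in> ?T"
      then show "card (containing \<W> S) \<le> (s - t + 1) ^ (s - t)"
        using branch[of S "s - t"] size[OF B0] ts finite_subset by auto
    qed
    also have "card ?T = s choose t" using size[OF B0] by (simp add: n_subsets)
    finally show ?thesis .
  qed simp
qed

text \<open>
  Enlarge \<open>\<G>\<close> to a maximal \<open>t\<close>-intersecting family of sets of size at most \<open>s\<close>. By maximality,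
  a proper subset of a minimal member is rejected by some member of size at most \<open>s\<close> (not \<open>k\<close>),
  so the branching count has base \<open>s - t + 1\<close>, which is what makes a bound cubic in \<open>k\<close> suffice.
\<close>

lemma peel_step:
  assumes A: "finite A" and \<G>: "\<G> \<subseteq> Pow A" "t_intersecting t \<G>" "\<And>G. G \<in> \<G> \<Longrightarrow> card G \<le> s"
  obtains \<H> \<W> where "\<H> \<subseteq> Pow A" "t_intersecting t \<H>" "\<And>G. G \<in> \<H> \<Longrightarrow> card G < s"
    "\<W> \<subseteq> Pow A" "\<And>G. G \<in> \<W> \<Longrightarrow> card G = s" "card \<W> \<le> (s choose t) * (s - t + 1) ^ (s - t)"
    "\<And>G. G \<in> \<G> \<Longrightarrow> \<exists>H \<in> \<H> \<union> \<W>. H \<subseteq> G"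
proof -
  define \<Omega> where "\<Omega> = {\<T>. \<T> \<subseteq> Pow A \<and> t_intersecting t \<T> \<and> (\<forall>G\<in>\<T>. card G \<le> s)}"
  have "finite \<Omega>" by (rule finite_subset[of _ "Pow (Pow A)"]) (use A in \<open>auto simp: \<Omega>_def\<close>)
  moreover have "\<G> \<in> \<Omega>" using \<G> by (auto simp: \<Omega>_def)
  ultimately obtain \<T> where \<T>: "\<T> \<in> \<Omega>" "\<G> \<subseteq> \<T>" and max: "\<And>\<T>'. \<T>' \<in> \<Omega> \<Longrightarrow> \<T> \<subseteq> \<T>' \<Longrightarrow> \<T> = \<T>'"
    using finite_has_maximal2 by metis
  have sub: "\<T> \<subseteq> Pow A" and int: "t_intersecting t \<T>" and le: "\<And>G. G \<in> \<T> \<Longrightarrow> card G \<le> s"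
    using \<T> by (auto simp: \<Omega>_def)
  define \<H> where "\<H> = {G \<in> \<T>. card G < s}"
  \<comment> \<open>A member of size s that is not minimal contains a member of \<open>\<H>\<close>,
    so only the minimal ones have to be peeled off.\<close>
  define \<W> where "\<W> = {G \<in> \<T>. card G = s \<and> (\<forall>S. S \<subset> G \<longrightarrow> S \<notin> \<T>)}"
  have finG: "finite G" if "G \<in> \<T>" for G using that sub A finite_subset by blast
  have "card \<W> \<le> (s choose t) * (s - t + 1) ^ (s - t)"
  proof (rule card_minimal_members_le)
    show "finite \<W>" using sub A by (auto simp: \<W>_def intro: finite_subset[of _ "Pow A"])
    show "t_intersecting t \<W>" using int by (auto simp: \<W>_def t_intersecting_def)
    show "finite B \<and> card B = s" if "B \<in> \<W>" for B using that finG by (auto simp: \<W>_def)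
    fix B S assume B: "B \<in> \<W>" and S: "S \<subset> B"
    have BT: "B \<in> \<T>" "S \<notin> \<T>" "card B = s" using B S by (auto simp: \<W>_def)
    have SA: "S \<subseteq> A" using S BT sub by blast
    have Ss: "card S \<le> s" using S BT finG[of B] by (metis card_mono psubset_imp_subset)
    have "insert S \<T> \<notin> \<Omega>" using max[of "insert S \<T>"] BT by blast
    then have "\<not> t_intersecting t (insert S \<T>)"
      using sub le SA Ss by (auto simp: \<Omega>_def)
    \<comment> \<open>\<open>S\<close> is rejected by a member of \<open>\<T>\<close> or by its own
      size. In the latter case \<open>B\<close> itself meets \<open>S\<close> in fewer than t points
      and serves as \<open>B'\<close>.\<close>
    then have "card S < t \<or> (\<exists>B'\<in>\<T>. card (S \<inter> B') < t)"
      using int unfolding t_intersecting_def by (auto simp: not_le Int_commute)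
    then obtain B' where B': "B' \<in> \<T>" "card (S \<inter> B') < t"
      using BT(1) S by (metis Int_absorb2 psubset_imp_subset)
    have "\<forall>B\<in>\<W>. t \<le> card (B \<inter> B')"
      using int B'(1) by (simp add: \<W>_def t_intersecting_def)
    then show "\<exists>B'. finite B' \<and> card B' \<le> s \<and> card (S \<inter> B') < t \<and> (\<forall>B\<in>\<W>. t \<le> card (B \<inter> B'))"
      using finG le B' by blast
  qed
  moreover have "\<exists>H \<in> \<H> \<union> \<W>. H \<subseteq> G" if "G \<in> \<G>" for G
  proof (cases "G \<in> \<W>")
    case False
    have GT: "G \<in> \<T>" using that \<T> by blast
    have "G \<notin> \<W> \<Longrightarrow> card G \<noteq> s \<or> (\<exists>S. S \<subset> G \<and> S \<in> \<T>)"
      using GT unfolding \<W>_def by simp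
    then consider "card G < s" | S where "S \<subset> G" "S \<in> \<T>"
      using False le[OF GT] le_neq_implies_less by metis
    then show ?thesis
    proof cases
      case 1 then show ?thesis using GT by (auto simp: \<H>_def)
    next
      case 2
      then have "card S < s" using psubset_card_mono[OF finG[OF GT] 2(1)] le[OF GT] by simp
      then show ?thesis using 2 by (auto simp: \<H>_def)
    qed
  qed auto
  moreover have "\<H> \<subseteq> Pow A" "\<W> \<subseteq> Pow A" using sub by (auto simp: \<H>_def \<W>_def)
  moreover have "t_intersecting t \<H>" using int by (auto simp: \<H>_def t_intersecting_def)
  moreover have "\<And>G. G \<in> \<H> \<Longrightarrow> card G < s" "\<And>G. G \<in> \<W> \<Longrightarrow> card G = s"
    by (simp_all add: \<H>_def \<W>_def)
  ultimately show thesis by (intro that[of \<H> \<W>])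
qed

text \<open>Downward induction on r, starting at r = k, where \<open>\<F>\<close> covers itself. The
  step to r loses only k-sets above a peeled set of size s = r + 1, and each such set lies in
  \<open>(card A - s) choose (k - s)\<close> of them.\<close>

lemma peel:
  assumes A: "finite A" and \<F>: "\<F> \<subseteq> nsets A k" "t_intersecting t \<F>" and "r \<le> k"
  shows "\<exists>\<G>. \<G> \<subseteq> Pow A \<and> t_intersecting t \<G> \<and> (\<forall>G\<in>\<G>. card G \<le> r) \<and>
     card {F \<in> \<F>. \<not> (\<exists>G\<in>\<G>. G \<subseteq> F)}
       \<le> (\<Sum>s\<in>{r<..k}. (s choose t) * (s - t + 1) ^ (s - t) * ((card A - s) choose (k - s)))"
  using \<open>r \<le> k\<close>
proof (induction r rule: inc_induct)
  case base
  have "{F \<in> \<F>. \<not> (\<exists>G\<in>\<F>. G \<subseteq> F)} = {}" by auto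
  then have "card {F \<in> \<F>. \<not> (\<exists>G\<in>\<F>. G \<subseteq> F)} = 0" by (simp only: card.empty)
  then show ?case using \<F> by (intro exI[of _ \<F>]) (auto simp: nsets_def)
next
  case (step r)
  let ?weight = "\<lambda>s. (s choose t) * (s - t + 1) ^ (s - t) * ((card A - s) choose (k - s))"
  from step.IH obtain \<G> where \<G>: "\<G> \<subseteq> Pow A" "t_intersecting t \<G>" "\<And>G. G\<in>\<G> \<Longrightarrow> card G \<le> Suc r"
    and rest: "card {F \<in> \<F>. \<not> (\<exists>G\<in>\<G>. G \<subseteq> F)} \<le> (\<Sum>s\<in>{Suc r<..k}. ?weight s)" by blast
  obtain \<H> \<W> where \<H>: "\<H> \<subseteq> Pow A" "t_intersecting t \<H>" "\<And>G. G \<in> \<H> \<Longrightarrow> card G < Suc r"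
    and \<W>: "\<W> \<subseteq> Pow A" "\<And>G. G \<in> \<W> \<Longrightarrow> card G = Suc r"
       "card \<W> \<le> (Suc r choose t) * (Suc r - t + 1) ^ (Suc r - t)"
    and cov: "\<And>G. G \<in> \<G> \<Longrightarrow> \<exists>H \<in> \<H> \<union> \<W>. H \<subseteq> G"
    using peel_step[OF A \<G>] by metis
  have fin: "finite \<F>" "finite \<W>"
    using \<F>(1) A \<W>(1) by (auto intro: finite_subset simp: finite_imp_finite_nsets)
  have "{F \<in> \<F>. \<not> (\<exists>G\<in>\<H>. G \<subseteq> F)}
        \<subseteq> {F \<in> \<F>. \<not> (\<exists>G\<in>\<G>. G \<subseteq> F)} \<union> (\<Union>W\<in>\<W>. {F \<in> nsets A k. W \<subseteq> F})"
  proof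
    fix F assume "F \<in> {F \<in> \<F>. \<not> (\<exists>G\<in>\<H>. G \<subseteq> F)}"
    then have F: "F \<in> \<F>" "\<And>H. H \<in> \<H> \<Longrightarrow> \<not> H \<subseteq> F" by auto
    show "F \<in> {F \<in> \<F>. \<not> (\<exists>G\<in>\<G>. G \<subseteq> F)} \<union> (\<Union>W\<in>\<W>. {F \<in> nsets A k. W \<subseteq> F})"
    proof (cases "\<exists>G\<in>\<G>. G \<subseteq> F")
      case True
      then obtain G where G: "G \<in> \<G>" "G \<subseteq> F" by blast
      obtain H where "H \<in> \<H> \<union> \<W>" "H \<subseteq> G" using cov[OF G(1)] by blast
      then have "H \<in> \<W>" "H \<subseteq> F" using F(2) G(2) by auto
      then show ?thesis using F(1) \<F>(1) by auto
    qed (use F in simp)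
  qed
  then have "card {F \<in> \<F>. \<not> (\<exists>G\<in>\<H>. G \<subseteq> F)}
        \<le> card ({F \<in> \<F>. \<not> (\<exists>G\<in>\<G>. G \<subseteq> F)} \<union> (\<Union>W\<in>\<W>. {F \<in> nsets A k. W \<subseteq> F}))"
    using fin A by (intro card_mono) (auto simp: finite_imp_finite_nsets)
  also have "\<dots> \<le> card {F \<in> \<F>. \<not> (\<exists>G\<in>\<G>. G \<subseteq> F)} + card (\<Union>W\<in>\<W>. {F \<in> nsets A k. W \<subseteq> F})"
    by (rule card_Un_le)
  also have "card (\<Union>W\<in>\<W>. {F \<in> nsets A k. W \<subseteq> F}) \<le> card \<W> * ((card A - Suc r) choose (k - Suc r))"
  proof (rule card_UN_le_mult[OF fin(2)])
    show "card {F \<in> nsets A k. W \<subseteq> F} \<le> (card A - Suc r) choose (k - Suc r)" if "W \<in> \<W>" for W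
      using card_nsets_superset[of A W k] A \<W> that step.hyps by auto
  qed
  also have "\<dots> \<le> ?weight (Suc r)" using \<W>(3) by (rule mult_right_mono) simp
  finally have "card {F \<in> \<F>. \<not> (\<exists>G\<in>\<H>. G \<subseteq> F)} \<le> (\<Sum>s\<in>{Suc r<..k}. ?weight s) + ?weight (Suc r)"
    using rest by linarith
  also have "\<dots> = (\<Sum>s\<in>{r<..k}. ?weight s)"
  proof -
    have "{r<..k} = insert (Suc r) {Suc r<..k}" using step.hyps by auto
    then show ?thesis by simp
  qed
  finally show ?case using \<H> by (intro exI[of _ \<H>]) (auto simp: less_Suc_eq_le)
qed

section \<open>Numerical estimates\<close>

text \<open>This is (1 + 1/m)^m \<le> e \<le> 3 with denominators cleared. It controls the growth of
  the branching factor \<open>(s - t + 1) ^ (s - t)\<close> from one s to the next.\<close>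

lemma Suc_power_le_three_mult: "(m + 1) ^ m \<le> 3 * m ^ m" if "0 < m" for m :: nat
proof -
  have "(1 + 1 / real m) ^ m \<le> exp 1"
    using exp_ge_one_plus_x_over_n_power_n[of m 1] that by simp
  also have "\<dots> \<le> 3" by (rule exp_le)
  finally have "(1 + 1 / real m) ^ m * real m ^ m \<le> 3 * real m ^ m"
    by (rule mult_right_mono) simp
  also have "(1 + 1 / real m) ^ m * real m ^ m = real (m + 1) ^ m"
    using that by (simp flip: power_mult_distrib add: field_simps)
  finally have "real ((m + 1) ^ m) \<le> real (3 * m ^ m)" by simp
  then show ?thesis by (simp only: of_nat_le_iff)
qed

section \<open>Consequences of the lower bound on n\<close>

locale large_ground_set =
  fixes n k t :: nat
  assumes k: "t + 2 \<le> k" and t: "2 \<le> t" and n: "7 * (k - t + 1) * k ^ 2 \<le> n"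
begin

text \<open>\<open>C1\<close> and \<open>C2\<close> count the k-sets through a fixed (t+1)-set and a
  fixed (t+2)-set. \<open>weight s\<close> bounds the loss in \<open>peel\<close> at level
  s.\<close>

abbreviation "C1 \<equiv> (n - t - 1) choose (k - t - 1)"
abbreviation "C2 \<equiv> (n - t - 2) choose (k - t - 2)"
abbreviation "weight s \<equiv> (s choose t) * (s - t + 1) ^ (s - t) * ((n - s) choose (k - s))"

lemma k_ge: "4 \<le> k"
  using k t by simp

lemma n_ge: "21 * k\<^sup>2 \<le> n" "84 * k \<le> n"
proof -
  have "7 * 3 * k\<^sup>2 \<le> 7 * (k - t + 1) * k\<^sup>2" using k by (intro mult_right_mono) auto
  also note n
  finally show *: "21 * k\<^sup>2 \<le> n" by simp
  have "4 * k \<le> k\<^sup>2" using k_ge by (simp add: power2_eq_square)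
  then show "84 * k \<le> n" using * by linarith
qed

lemma C2_pos: "0 < C2"
proof -
  have "k \<le> n" using n_ge(2) by linarith
  then have "k - t - 2 \<le> n - t - 2" by (intro diff_le_mono)
  then show ?thesis by (rule zero_less_binomial)
qed

text \<open>The quotient of \<open>C1\<close> and \<open>C2\<close> is (n - t - 1) / (k - t - 1).
  The bound on n has k - t + 1 in place of k - t - 1, and the surplus 14 k^2 absorbs t + 1.\<close>

lemma C2_le_C1: "7 * k\<^sup>2 * C2 \<le> C1"
proof -
  have "(k - t - 1) * C1 = (n - t - 1) * C2"
    using times_binomial_minus1_eq[of "k - t - 1" "n - t - 1"] k by simp
  moreover have "7 * k\<^sup>2 * (k - t - 1) \<le> n - t - 1"
  proof -
    have e: "k - t + 1 = (k - t - 1) + 2" using k by simp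
    have "7 * (k - t + 1) * k\<^sup>2 = 7 * k\<^sup>2 * (k - t - 1) + 14 * k\<^sup>2"
      unfolding e by (simp add: algebra_simps)
    moreover have "k * 1 \<le> k\<^sup>2" unfolding power2_eq_square using k_ge by (intro mult_left_mono) auto
    then have "t + 1 \<le> k\<^sup>2" using k by linarith
    ultimately show ?thesis using n by linarith
  qed
  then have "7 * k\<^sup>2 * (k - t - 1) * C2 \<le> (n - t - 1) * C2" by (rule mult_right_mono) simp
  ultimately have "(k - t - 1) * (7 * k\<^sup>2 * C2) \<le> (k - t - 1) * C1"
    by (simp add: ac_simps)
  then show ?thesis using k by simp
qed

text \<open>Pascal's rule m times: lowering the top entry by one costs a coefficient with bottom
  entry \<open>k - t - 2\<close>, which is at most \<open>C2\<close>.\<close>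

lemma C1_decay: "C1 \<le> ((n - t - 1 - m) choose (k - t - 1)) + m * C2"
proof (induction m)
  case (Suc m)
  show ?case
  proof (cases "n - t - 1 - m = 0")
    case False
    then have "(n - t - 1 - m) choose (k - t - 1)
        = ((n - t - 1 - Suc m) choose (k - t - 2)) + ((n - t - 1 - Suc m) choose (k - t - 1))"
      using k choose_reduce_nat[of "n - t - 1 - m" "k - t - 1"] by (simp add: numeral_2_eq_2)
    moreover have "(n - t - 1 - Suc m) choose (k - t - 2) \<le> C2"
      by (intro binomial_right_mono) simp
    ultimately show ?thesis using Suc by simp
  qed (use Suc in simp)
qed simp

lemma binomial_diff_step:
  assumes "m + 1 \<le> n - t"
  shows "((n - t - (m + 1)) choose (k - t)) + C1 \<le> ((n - t - m) choose (k - t)) + m * C2"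
proof -
  have "(n - t - m) choose (k - t)
      = ((n - t - 1 - m) choose (k - t - 1)) + ((n - t - (m + 1)) choose (k - t))"
    using assms k choose_reduce_nat[of "n - t - m" "k - t"] by simp
  then show ?thesis using C1_decay[of m] by simp
qed

text \<open>Sums \<open>binomial_diff_step\<close> over m < r; the error 0 + ... + (r - 1) is
  rounded up to r * r.\<close>

lemma binomial_diff_ge:
  assumes "r \<le> n - t"
  shows "((n - t - r) choose (k - t)) + r * C1 \<le> ((n - t) choose (k - t)) + r * r * C2"
  using assms
proof (induction r)
  case (Suc r)
  then show ?case using binomial_diff_step[of r] by (simp add: algebra_simps)
qed simp

text \<open>If d is so large that the top entry drops below k - t, the left side is 0. Otherwise no
  subtraction truncates and the coefficient is monotone in its top entry.\<close>

lemma int_binom_le: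
  assumes "r \<le> d"
  shows "int_binom (int n - int t - int d) (int k - int t) \<le> (n - t - r) choose (k - t)"
proof (cases "int n - int t - int d < int k - int t")
  case False
  then have "nat (int n - int t - int d) = n - t - d" "nat (int k - int t) = k - t" by auto
  then show ?thesis using assms k by (auto simp: int_binom_def intro: binomial_right_mono)
qed (simp add: int_binom_def)

text \<open>With i = s - t, the quotient of the two weights is (s+1)/(i+1) * (i+2)^(i+1)/(i+1)^i *
  (k-s)/(n-s). The powers contribute at most 3 (i+1), so the quotient is at most 3 (s+1)(k-s)/(n-s),
  which the size of n keeps below 1/9. Everything is multiplied by n - s to stay in the
  naturals.\<close>

lemma nine_weight_Suc_le:
  assumes "t + 2 \<le> s" "s < k"
  shows "9 * weight (Suc s) \<le> weight s"
proof -
  define i where "i = s - t"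
  have s: "s = t + i" "2 \<le> i" using assms by (auto simp: i_def)
  have 1: "(Suc s choose t) * (i + 1) = Suc s * (s choose t)"
    using binomial_absorb_comp[of "Suc s" t] s by (simp add: mult.commute)
  have 2: "((n - Suc s) choose (k - Suc s)) * (n - s) = (k - s) * ((n - s) choose (k - s))"
    using times_binomial_minus1_eq[of "k - s" "n - s"] assms by (simp add: mult.commute)
  have 3: "(i + 2) ^ (i + 1) \<le> 3 * (i + 1) ^ (i + 1)"
    using Suc_power_le_three_mult[of "i + 1"] by (simp add: numeral_2_eq_2)
  \<comment> \<open>27 copies of \<open>k * (k - t + 1)\<close> bound the product and a 28th pays
    for s; 28 = 7 * 4 and k \<ge> 4.\<close>
  have 4: "27 * (Suc s * (k - s)) \<le> n - s"
  proof -
    have "27 * (Suc s * (k - s)) \<le> 27 * (k * (k - t + 1))"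
      using assms by (intro mult_left_mono mult_mono) auto
    moreover have "28 * (k * (k - t + 1)) \<le> 7 * (k - t + 1) * k\<^sup>2"
    proof -
      have "28 * (k * c) = 7 * c * (4 * k)" for c :: nat by simp
      then have "28 * (k * (k - t + 1)) = 7 * (k - t + 1) * (4 * k)" .
      also have "\<dots> \<le> 7 * (k - t + 1) * k\<^sup>2"
        using k_ge by (intro mult_left_mono) (auto simp: power2_eq_square)
      finally show ?thesis .
    qed
    moreover have "k * 1 \<le> k * (k - t + 1)" by (intro mult_left_mono) auto
    ultimately show ?thesis using n assms by linarith
  qed
  have "9 * weight (Suc s) * (n - s)
      = 9 * ((Suc s choose t) * (i + 2) ^ (i + 1)) * (((n - Suc s) choose (k - Suc s)) * (n - s))"
    by (simp add: s)
  also have "\<dots> = 9 * ((Suc s choose t) * (i + 2) ^ (i + 1)) * ((k - s) * ((n - s) choose (k - s)))"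
    by (simp only: 2)
  also have "\<dots> \<le> 9 * ((Suc s choose t) * (3 * (i + 1) ^ (i + 1))) * ((k - s) * ((n - s) choose (k - s)))"
    using 3 by (intro mult_right_mono mult_left_mono) auto
  also have "\<dots> = 27 * (((Suc s choose t) * (i + 1)) * (i + 1) ^ i * ((k - s) * ((n - s) choose (k - s))))"
    by (simp add: algebra_simps)
  also have "\<dots> = 27 * (Suc s * (k - s)) * weight s"
    unfolding 1 by (simp add: s algebra_simps)
  also have "\<dots> \<le> (n - s) * weight s" using 4 by (intro mult_right_mono) auto
  finally have "9 * weight (Suc s) * (n - s) \<le> weight s * (n - s)" by (simp add: mult.commute)
  moreover have "0 < n - s" using n_ge assms by linarith
  ultimately show ?thesis by (simp only: mult_le_cancel2)
qed

text \<open>A geometric series with ratio at most 1/9 sums to at most 9/8 of its first term.\<close>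

lemma sum_weight_le:
  assumes "t + 1 \<le> r" "r < k"
  shows "8 * (\<Sum>s\<in>{r<..k}. weight s) \<le> 9 * weight (Suc r)"
proof -
  have "r \<le> k - 1" using assms by simp
  then show ?thesis
  proof (induction r rule: inc_induct)
    case base
    have "{k - 1<..k} = {k}" using k by auto
    moreover have "Suc (k - 1) = k" using k by simp
    ultimately show ?case by simp
  next
    case (step r')
    have "{r'<..k} = insert (Suc r') {Suc r'<..k}" using step.hyps by auto
    then have "8 * (\<Sum>s\<in>{r'<..k}. weight s) = 8 * weight (Suc r') + 8 * (\<Sum>s\<in>{Suc r'<..k}. weight s)"
      by simp
    also have "\<dots> \<le> 8 * weight (Suc r') + 9 * weight (Suc (Suc r'))"
      using step.IH by (rule add_left_mono)
    also have "\<dots> \<le> 8 * weight (Suc r') + weight (Suc r')"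
      using assms step.hyps by (intro add_left_mono nine_weight_Suc_le) auto
    finally show ?case by linarith
  qed
qed

text \<open>The first term, at s = t + 2, is (t+2)(t+1)/2 * 3^2 * \<open>C2\<close>, and 9/8 * 9/2 =
  81/16.\<close>

lemma sum_weight_le_C2: "16 * (\<Sum>s\<in>{t + 1<..k}. weight s) \<le> 81 * (k * (k - 1)) * C2"
proof -
  have "Suc (t + 1) choose t = Suc (t + 1) choose 2"
    using binomial_symmetric[of t "t + 2"] by simp
  then have "2 * (Suc (t + 1) choose t) = (t + 2) * (t + 1)"
    using choose_two[of "t + 2"] by simp
  also have "\<dots> \<le> k * (k - 1)" using k by (intro mult_mono) auto
  finally have "81 * (2 * (Suc (t + 1) choose t)) * C2 \<le> 81 * (k * (k - 1)) * C2"
    by (intro mult_right_mono mult_left_mono) auto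
  moreover have "8 * (\<Sum>s\<in>{t + 1<..k}. weight s) \<le> 9 * weight (Suc (t + 1))"
    using k by (intro sum_weight_le) auto
  moreover have "weight (Suc (t + 1)) = (Suc (t + 1) choose t) * 9 * C2" by simp
  ultimately show ?thesis by linarith
qed

end

section \<open>Covers of size \<open>t + 1\<close>\<close>

text \<open>Without a common t-set all members have size t + 1, since a member of size t would be
  common to all. Two distinct members meet in exactly t points; a member not containing this
  intersection lies in their union, and it forces all others into the union as well.\<close>

lemma t_intersecting_structure:
  assumes A: "finite A" "t \<le> card A" and \<G>: "\<G> \<subseteq> Pow A" "t_intersecting t \<G>"
    and le: "\<And>G. G \<in> \<G> \<Longrightarrow> card G \<le> t + 1"
  shows "(\<exists>X\<subseteq>A. card X = t \<and> (\<forall>G\<in>\<G>. X \<subseteq> G)) \<or>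
         (\<exists>Z\<subseteq>A. card Z = t + 2 \<and> (\<forall>G\<in>\<G>. G \<subseteq> Z \<and> card G = t + 1))"
proof (rule disjCI)
  assume noZ: "\<not> (\<exists>Z\<subseteq>A. card Z = t + 2 \<and> (\<forall>G\<in>\<G>. G \<subseteq> Z \<and> card G = t + 1))"
  have fin: "finite G" if "G \<in> \<G>" for G using that \<G>(1) A(1) finite_subset by blast
  have int: "t \<le> card (G \<inter> G')" if "G \<in> \<G>" "G' \<in> \<G>" for G G'
    using \<G>(2) that by (auto simp: t_intersecting_def)
  have sub: "G \<subseteq> A" if "G \<in> \<G>" for G using that \<G>(1) by blast
  show "\<exists>X\<subseteq>A. card X = t \<and> (\<forall>G\<in>\<G>. X \<subseteq> G)"
  proof (rule ccontr)
    assume noX: "\<not> ?thesis"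
    have size: "card G = t + 1" if G: "G \<in> \<G>" for G
    proof (rule ccontr)
      assume "card G \<noteq> t + 1"
      then have c: "card G = t" using le[OF G] int[OF G G] by simp
      have "G \<subseteq> G'" if "G' \<in> \<G>" for G'
      proof -
        have "G \<inter> G' = G" using int[OF G that] c fin[OF G] by (intro card_seteq) auto
        then show ?thesis by blast
      qed
      then show False using noX c sub[OF G] by blast
    qed
    \<comment> \<open>Shows that \<open>\<G>\<close> is nonempty: in an empty family every t-set
      counts as common.\<close>
    obtain X0 where "X0 \<subseteq> A" "card X0 = t" using A obtain_subset_with_card_n by metis
    then obtain G1 where G1: "G1 \<in> \<G>" using noX by blast
    obtain X1 where X1: "X1 \<subseteq> G1" "card X1 = t" using size[OF G1] obtain_subset_with_card_n[of t G1] by auto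
    then obtain G2 where G2: "G2 \<in> \<G>" "G1 \<noteq> G2" using noX sub[OF G1] by blast
    have c12: "card (G1 \<inter> G2) = t"
    proof (rule ccontr)
      assume "card (G1 \<inter> G2) \<noteq> t"
      then have "t + 1 \<le> card (G1 \<inter> G2)" using int[OF G1 G2(1)] by simp
      then have "G1 \<inter> G2 = G1" "G1 \<inter> G2 = G2"
        using size[OF G1] size[OF G2(1)]
        by (intro card_seteq fin[OF G1] fin[OF G2(1)] Int_lower1 Int_lower2; simp)+
      then show False using G2(2) by simp
    qed
    have cZ: "card (G1 \<union> G2) = t + 2"
      using card_Un_Int[OF fin[OF G1] fin[OF G2(1)]] size[OF G1] size[OF G2(1)] c12 by simp
    \<comment> \<open>By inclusion-exclusion \<open>G\<close> has at least t + t - (t - 1) = t + 1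
      points in the union, hence all its points.\<close>
    have outside: "G \<subseteq> G1 \<union> G2 \<and> card (G \<inter> (G1 \<inter> G2)) < t" if G: "G \<in> \<G>" "\<not> G1 \<inter> G2 \<subseteq> G" for G
    proof -
      have "G \<inter> (G1 \<inter> G2) \<subset> G1 \<inter> G2" using G(2) by blast
      then have l: "card (G \<inter> (G1 \<inter> G2)) < t"
        using psubset_card_mono[of "G1 \<inter> G2" "G \<inter> (G1 \<inter> G2)"] c12 fin[OF G1] by simp
      have "G \<inter> G1 \<union> G \<inter> G2 = G \<inter> (G1 \<union> G2)" "G \<inter> G1 \<inter> (G \<inter> G2) = G \<inter> (G1 \<inter> G2)" by blast+
      then have "card (G \<inter> G1) + card (G \<inter> G2) = card (G \<inter> (G1 \<union> G2)) + card (G \<inter> (G1 \<inter> G2))"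
        using card_Un_Int[of "G \<inter> G1" "G \<inter> G2"] fin[OF G(1)] by simp
      then have "t + 1 \<le> card (G \<inter> (G1 \<union> G2))" using int[OF G(1) G1] int[OF G(1) G2(1)] l by simp
      then have "G \<inter> (G1 \<union> G2) = G" using size[OF G(1)] fin[OF G(1)] by (intro card_seteq) auto
      then show ?thesis using l by blast
    qed
    obtain G3 where G3: "G3 \<in> \<G>" "\<not> G1 \<inter> G2 \<subseteq> G3" using noX c12 sub[OF G1] by blast
    have "G \<subseteq> G1 \<union> G2" if G: "G \<in> \<G>" for G
    proof (cases "G1 \<inter> G2 \<subseteq> G")
      case True
      have "card (G - (G1 \<inter> G2)) = 1"
        using True size[OF G] c12 fin[OF G1] by (subst card_Diff_subset) auto
      then obtain c where c: "G - (G1 \<inter> G2) = {c}" by (auto simp: card_1_singleton_iff)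
      \<comment> \<open>\<open>G\<close> consists of \<open>G1 \<inter> G2\<close> and the point
        \<open>c\<close>. If \<open>G3\<close> lacked \<open>c\<close>, it would meet
        \<open>G\<close> only inside \<open>G1 \<inter> G2\<close>, in fewer than t points.\<close>
      have "c \<in> G3"
      proof (rule ccontr)
        assume "c \<notin> G3"
        moreover have "G \<subseteq> insert c (G1 \<inter> G2)" using c by blast
        ultimately have "G3 \<inter> G \<subseteq> G3 \<inter> (G1 \<inter> G2)" by blast
        then have "card (G3 \<inter> G) \<le> card (G3 \<inter> (G1 \<inter> G2))" using fin[OF G3(1)] by (intro card_mono) auto
        then show False using int[OF G3(1) G] outside[OF G3] by linarith
      qed
      moreover have "G \<subseteq> insert c (G1 \<inter> G2)" using c by blast
      ultimately show ?thesis using outside[OF G3] by blast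
    qed (use outside[OF G] in blast)
    then have "G1 \<union> G2 \<subseteq> A \<and> card (G1 \<union> G2) = t + 2 \<and> (\<forall>G\<in>\<G>. G \<subseteq> G1 \<union> G2 \<and> card G = t + 1)"
      using cZ size sub[OF G1] sub[OF G2(1)] by simp
    then show False using noZ by blast
  qed
qed

text \<open>At most t - 1 points of \<open>X\<close> lie in \<open>F\<close>, so t common points
  with \<open>insert v X\<close> require \<open>v\<close> and all of \<open>X\<close> but one
  point.\<close>

lemma missing_exactly_one:
  assumes "finite X" "card X = t" "t \<le> card (F \<inter> insert v X)" "\<not> X \<subseteq> F" "finite F"
  shows "v \<in> F" "\<exists>x\<in>X. F \<inter> X = X - {x}"
proof -
  have "F \<inter> X \<subset> X" using assms(4) by blast
  then have l: "card (F \<inter> X) < t" using assms psubset_card_mono by metis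
  then show v: "v \<in> F" using assms(3) by (cases "v \<in> F") auto
  have "F \<inter> insert v X \<subseteq> insert v (F \<inter> X)" by blast
  then have "card (F \<inter> insert v X) \<le> card (insert v (F \<inter> X))" using assms(5) by (intro card_mono) auto
  also have "\<dots> \<le> Suc (card (F \<inter> X))" using assms(5) by (simp add: card_insert_if)
  finally have "card (F \<inter> X) = t - 1" using assms(3) l by simp
  moreover have "card (X - F) = card X - card (F \<inter> X)"
    using assms(1) by (metis card_Diff_subset_Int finite_Int inf_commute)
  ultimately have "card (X - F) = 1" using assms(2) l by simp
  then obtain x where "X - F = {x}" by (auto simp: card_1_singleton_iff)
  then show "\<exists>x\<in>X. F \<inter> X = X - {x}" by blast
qed

text \<open>The second part of \<open>family_L\<close>, named because the members not containing
  \<open>X\<close> are located in it and counted through it.\<close>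

definition almost_containing :: "nat \<Rightarrow> nat \<Rightarrow> nat set \<Rightarrow> nat set \<Rightarrow> nat set set" where
  "almost_containing n k X U = {F \<in> nsets {1..n} k. \<exists>x\<in>X. F \<inter> U = U - {x}}"

lemma card_almost_containing_le:
  assumes "U \<subseteq> {1..n}" "X \<subseteq> U" "card U \<le> k + 1"
  shows "card (almost_containing n k X U) \<le> card X * ((n - card U) choose (k + 1 - card U))"
proof -
  have fin: "finite U" "finite X" using assms finite_subset[of _ "{1..n}"] by auto
  have "almost_containing n k X U \<subseteq> (\<Union>x\<in>X. {F \<in> nsets {1..n} k. U - {x} \<subseteq> F \<and> F \<inter> {x} = {}})"
    using assms(2) unfolding almost_containing_def by fast
  then have "card (almost_containing n k X U)
      \<le> card (\<Union>x\<in>X. {F \<in> nsets {1..n} k. U - {x} \<subseteq> F \<and> F \<inter> {x} = {}})"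
    using fin by (intro card_mono) (auto simp: finite_imp_finite_nsets)
  also have "\<dots> \<le> card X * ((n - card U) choose (k + 1 - card U))"
  proof (rule card_UN_le_mult[OF fin(2)])
    fix x assume x: "x \<in> X"
    have c: "card (U - {x}) = card U - 1" "0 < card U"
      using x assms(2) fin by (auto simp: card_gt_0_iff)
    have "n - (card U - 1) - 1 = n - card U" "k - (card U - 1) = k + 1 - card U"
      using c(2) by simp_all
    moreover have "card {F \<in> nsets {1..n} k. U - {x} \<subseteq> F \<and> F \<inter> {x} = {}}
        = (n - (card U - 1) - 1) choose (k - (card U - 1))"
    proof -
      have "U - {x} \<subseteq> {1..n}" "{x} \<subseteq> {1..n}" "(U - {x}) \<inter> {x} = {}" "card (U - {x}) \<le> k"
        using x assms c by auto
      from card_nsets_superset_disjoint[OF _ this] show ?thesis by (simp only: c(1)) simp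
    qed
    ultimately show "card {F \<in> nsets {1..n} k. U - {x} \<subseteq> F \<and> F \<inter> {x} = {}}
        \<le> (n - card U) choose (k + 1 - card U)" by simp
  qed
  finally show ?thesis .
qed

text \<open>Complementary counting, written as a sum to avoid truncated subtraction.\<close>

lemma card_superset_meeting:
  assumes "finite A" "X \<subseteq> A" "V \<subseteq> A" "X \<inter> V = {}" "card X \<le> k"
  shows "card {F \<in> nsets A k. X \<subseteq> F \<and> F \<inter> V \<noteq> {}} + ((card A - card X - card V) choose (k - card X))
       = (card A - card X) choose (k - card X)"
proof -
  let ?M = "{F \<in> nsets A k. X \<subseteq> F \<and> F \<inter> V \<noteq> {}}" and ?N = "{F \<in> nsets A k. X \<subseteq> F \<and> F \<inter> V = {}}"
  have "card (?M \<union> ?N) = card ?M + card ?N"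
    using assms(1) by (intro card_Un_disjoint) (auto simp: finite_imp_finite_nsets)
  moreover have "?M \<union> ?N = {F \<in> nsets A k. X \<subseteq> F}" by blast
  ultimately show ?thesis
    using card_nsets_superset[of A X k] card_nsets_superset_disjoint[of A X V k] assms by simp
qed

lemma Diff_singleton_subset:
  assumes "finite Z" "Z \<noteq> {}" "card Z \<le> card (F \<inter> Z) + 1"
  shows "\<exists>z\<in>Z. Z - {z} \<subseteq> F"
proof -
  have "card (Z - F) \<le> 1"
    using assms card_Diff_subset_Int[of Z F] by (simp add: inf_commute)
  then have "Z - F = {} \<or> (\<exists>z. Z - F = {z})"
    using assms(1) by (metis One_nat_def card_0_eq card_1_singletonE finite_Diff le_0_eq le_SucE)
  then show ?thesis using assms(2) by blast
qed

text \<open>If \<open>F\<close> meets \<open>Z\<close> in at most t points, each cover inside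
  \<open>Z\<close> forces \<open>F \<inter> Z\<close> to have exactly t points and to lie in that
  cover. Only two (t+1)-sets lie between a t-set and a (t+2)-set.\<close>

lemma subset_family_A_of_three_covers:
  assumes Z: "finite Z" "card Z = t + 2" and \<C>: "finite \<C>" "2 < card \<C>"
    "\<And>G. G \<in> \<C> \<Longrightarrow> G \<subseteq> Z \<and> card G = t + 1" "\<And>G F. G \<in> \<C> \<Longrightarrow> F \<in> \<F> \<Longrightarrow> t \<le> card (F \<inter> G)"
    and \<F>: "\<F> \<subseteq> nsets {1..n} k"
  shows "\<F> \<subseteq> family_A n k t Z"
proof
  fix F assume F: "F \<in> \<F>"
  have "t + 1 \<le> card (F \<inter> Z)"
  proof (rule ccontr)
    assume "\<not> t + 1 \<le> card (F \<inter> Z)"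
    then have l: "card (F \<inter> Z) \<le> t" by simp
    have sub: "F \<inter> Z \<subseteq> G" if G: "G \<in> \<C>" for G
    proof -
      have "F \<inter> G = F \<inter> Z" using \<C>(3)[OF G] \<C>(4)[OF G F] Z(1) l by (intro card_seteq) auto
      then show ?thesis by blast
    qed
    have c: "card (F \<inter> Z) = t"
    proof -
      obtain G where G: "G \<in> \<C>" using \<C>(2) by fastforce
      have "card (F \<inter> G) \<le> card (F \<inter> Z)" using \<C>(3)[OF G] Z(1) by (intro card_mono) auto
      then show ?thesis using l \<C>(4)[OF G F] by linarith
    qed
    have "\<C> \<subseteq> {G \<in> nsets Z (t + 1). F \<inter> Z \<subseteq> G}"
    proof
      fix G assume G: "G \<in> \<C>"
      have "finite G" using \<C>(3)[OF G] Z(1) finite_subset by blast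
      then show "G \<in> {G \<in> nsets Z (t + 1). F \<inter> Z \<subseteq> G}"
        using sub[OF G] \<C>(3)[OF G] by (simp add: nsets_def)
    qed
    then have "card \<C> \<le> card {G \<in> nsets Z (t + 1). F \<inter> Z \<subseteq> G}"
      using Z(1) by (intro card_mono) (auto simp: finite_imp_finite_nsets)
    also have "\<dots> = 2" using card_nsets_superset[of Z "F \<inter> Z" "t + 1"] Z c by simp
    finally show False using \<C>(2) by simp
  qed
  then show "F \<in> family_A n k t Z" using F \<F> by (auto simp: family_A_def)
qed

section \<open>Covers that extend a t-set by one point\<close>

definition cover_vertices :: "nat \<Rightarrow> nat \<Rightarrow> nat set set \<Rightarrow> nat set \<Rightarrow> nat set" where
  "cover_vertices n t \<F> X = {v \<in> {1..n} - X. \<forall>F\<in>\<F>. t \<le> card (F \<inter> insert v X)}"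

text \<open>Applying \<open>missing_exactly_one\<close> to each v in \<open>V\<close> puts all of
  \<open>V\<close> into \<open>F\<close>; a single v already fixes the trace of \<open>F\<close> on
  \<open>X\<close>, which is where \<open>V \<noteq> {}\<close> enters.\<close>

lemma not_containing_subset_almost_containing:
  assumes "\<F> \<subseteq> nsets {1..n} k" "X \<in> nsets {1..n} t" "V \<subseteq> cover_vertices n t \<F> X" "V \<noteq> {}"
  shows "\<F> - containing \<F> X \<subseteq> almost_containing n k X (X \<union> V)"
proof
  fix F assume "F \<in> \<F> - containing \<F> X"
  then have F: "F \<in> \<F>" "\<not> X \<subseteq> F" by (auto simp: containing_def)
  have X: "finite X" "card X = t" using assms(2) by (auto simp: nsets_def)
  have F': "F \<in> nsets {1..n} k" "finite F" using F assms(1) by (auto simp: nsets_def)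
  have "t \<le> card (F \<inter> insert v X)" if "v \<in> V" for v
    using that assms(3) F(1) by (auto simp: cover_vertices_def)
  then have *: "v \<in> F" "\<exists>x\<in>X. F \<inter> X = X - {x}" if "v \<in> V" for v
    using missing_exactly_one[OF X _ F(2) F'(2), of v] that by blast+
  obtain x where "x \<in> X" "F \<inter> X = X - {x}" using *(2) assms(4) by blast
  moreover have "V \<subseteq> F" "X \<inter> V = {}" using *(1) assms(3) by (auto simp: cover_vertices_def)
  ultimately have "F \<inter> (X \<union> V) = X \<union> V - {x}" by blast
  then show "F \<in> almost_containing n k X (X \<union> V)"
    using F'(1) \<open>x \<in> X\<close> by (auto simp: almost_containing_def)
qed

text \<open>\<open>F\<close> has k points, among them all cover vertices and t - 1 points of
  \<open>X\<close>.\<close>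

lemma card_cover_vertices_le:
  assumes "\<F> \<subseteq> nsets {1..n} k" "X \<in> nsets {1..n} t" "F \<in> \<F>" "\<not> X \<subseteq> F" "t \<le> k"
  shows "card (cover_vertices n t \<F> X) \<le> k - t + 1"
proof (cases "cover_vertices n t \<F> X = {}")
  case False
  let ?V = "cover_vertices n t \<F> X"
  have F: "finite F" "card F = k" using assms by (auto simp: nsets_def)
  have X: "finite X" "card X = t" using assms(2) by (auto simp: nsets_def)
  have "F \<in> almost_containing n k X (X \<union> ?V)"
    using not_containing_subset_almost_containing[OF assms(1,2) _ False] assms(3,4)
    by (auto simp: containing_def)
  then obtain x where x: "x \<in> X" "F \<inter> (X \<union> ?V) = X \<union> ?V - {x}" by (auto simp: almost_containing_def)
  have d: "X \<inter> ?V = {}" by (auto simp: cover_vertices_def)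
  have fV: "finite ?V" by (rule finite_subset[of _ "{1..n}"]) (auto simp: cover_vertices_def)
  have "(X - {x}) \<union> ?V \<subseteq> F" using x d by blast
  then have "card ((X - {x}) \<union> ?V) \<le> k" using F card_mono by metis
  moreover have "card ((X - {x}) \<union> ?V) = (t - 1) + card ?V"
    using X x d fV by (subst card_Un_disjoint) auto
  moreover have "0 < card X" using X(1) x(1) by (auto simp: card_gt_0_iff)
  ultimately show ?thesis using assms(5) X(2) by linarith
qed simp

section \<open>Families satisfying the size hypothesis\<close>

context large_ground_set
begin

text \<open>
  For a \<open>t\<close>-set \<open>X\<close> and a disjoint \<open>d\<close>-set \<open>V\<close>, \<open>avoiding d\<close> counts the \<open>k\<close>-sets that contain \<open>X\<close> and
  miss \<open>V\<close>; \<open>missing d\<close> counts those that contain \<open>V\<close> and all of \<open>X\<close> except one given point.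
\<close>

abbreviation "avoiding d \<equiv> int_binom (int n - int t - int d) (int k - int t)"
abbreviation "missing d \<equiv> int_binom (int n - int t - int d) (int k - int t - int d + 1)"
abbreviation "large c d \<equiv> ((n - t) choose (k - t)) + t * missing d \<le> c + avoiding d"

lemma nt: "k \<le> n" "t \<le> n" "k + 2 \<le> n - t"
proof -
  show "k \<le> n" using n_ge(2) by linarith
  then show "t \<le> n" using k by linarith
  have "k + 2 + t \<le> n" using n_ge(2) k k_ge by linarith
  then show "k + 2 \<le> n - t" by simp
qed

lemma avoiding_eq: "d \<le> k - t + 1 \<Longrightarrow> avoiding d = (n - t - d) choose (k - t)"
proof -
  assume d: "d \<le> k - t + 1"
  have "84 * k \<le> n" by (rule n_ge)
  then have "\<not> int n - int t - int d < int k - int t" "\<not> int k - int t < 0"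
    "nat (int n - int t - int d) = n - t - d" "nat (int k - int t) = k - t"
    using d k by linarith+
  then show ?thesis by (simp add: int_binom_def)
qed

lemma missing_eq: "d \<le> k - t + 1 \<Longrightarrow> missing d = (n - t - d) choose (k - t + 1 - d)"
proof -
  assume d: "d \<le> k - t + 1"
  have "84 * k \<le> n" by (rule n_ge)
  then have "\<not> int k - int t - int d + 1 < 0" "\<not> int n - int t - int d < int k - int t - int d + 1"
    "nat (int n - int t - int d) = n - t - d" "nat (int k - int t - int d + 1) = k - t + 1 - d"
    using d k by linarith+
  then show ?thesis by (simp add: int_binom_def)
qed

text \<open>For d = 2 the difference of binomials gives two copies of \<open>C1\<close> and
  \<open>t * missing 2\<close> a third; for d \<ge> 3 the difference alone gives three. The third
  copy later rules out families with only two covers.\<close>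

lemma large_imp_ge:
  assumes "2 \<le> d" "large c d"
  shows "3 * C1 \<le> c + 9 * C2"
proof (cases "d = 2")
  case True
  have two: "2 \<le> k - t + 1" using k by simp
  have "avoiding 2 \<le> (n - t - 2) choose (k - t)" by (rule int_binom_le) simp
  moreover have "((n - t - 2) choose (k - t)) + 2 * C1 \<le> ((n - t) choose (k - t)) + 2 * 2 * C2"
    using nt by (intro binomial_diff_ge) linarith
  moreover have "1 * ((n - t - 2) choose (k - t - 1)) \<le> t * missing 2"
    unfolding missing_eq[of 2, OF two] using t by (intro mult_mono) auto
  moreover have "C1 \<le> ((n - t - 2) choose (k - t - 1)) + C2"
    using C1_decay[of 1] by (simp add: numeral_2_eq_2)
  ultimately show ?thesis using assms(2) unfolding True by linarith
next
  case False
  have "avoiding d \<le> (n - t - 3) choose (k - t)" using False assms(1) by (intro int_binom_le) simp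
  moreover have "((n - t - 3) choose (k - t)) + 3 * C1 \<le> ((n - t) choose (k - t)) + 3 * 3 * C2"
    using nt(3) k_ge by (intro binomial_diff_ge) linarith
  ultimately show ?thesis using assms(2) by linarith
qed

lemma C2_multiple_less_C1:
  assumes "m < 7 * k\<^sup>2"
  shows "m * C2 < C1"
proof -
  have "m * C2 < 7 * k\<^sup>2 * C2" using assms C2_pos by (rule mult_strict_right_mono)
  also note C2_le_C1
  finally show ?thesis .
qed

text \<open>As t \<ge> 2, both k - t + 1 and m are at most k - 1. After multiplication by 16 the
  coefficients of \<open>C2\<close> add up to less than 112 k^2 = 16 * 7 k^2, so
  \<open>C2_le_C1\<close> applies.\<close>

lemma deficit_less_C1:
  assumes "16 * R \<le> 81 * (k * (k - 1)) * C2" "m \<le> k - t + 1"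
  shows "R + (k - t + 1)\<^sup>2 * C2 + m * C2 < C1"
proof -
  obtain j where j: "k = j + 1"
    using k_ge by (metis add.commute le_add_diff_inverse one_le_numeral order_trans)
  have "(k - t + 1)\<^sup>2 \<le> j\<^sup>2" using j t k by (intro power_mono) auto
  moreover have "m \<le> j" using assms(2) j t k by linarith
  moreover have "81 * ((j + 1) * j) + 16 * j\<^sup>2 + 16 * j < 112 * (j + 1)\<^sup>2"
    by (simp add: power2_eq_square algebra_simps)
  moreover have "k * (k - 1) = (j + 1) * j" "k\<^sup>2 = (j + 1)\<^sup>2" using j by simp_all
  ultimately have "81 * (k * (k - 1)) + 16 * (k - t + 1)\<^sup>2 + 16 * m < 112 * k\<^sup>2"
    by linarith
  then have "(81 * (k * (k - 1)) + 16 * (k - t + 1)\<^sup>2 + 16 * m) * C2 < 112 * k\<^sup>2 * C2"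
    using C2_pos by (rule mult_strict_right_mono)
  moreover have "112 * k\<^sup>2 * C2 = 16 * (7 * k\<^sup>2 * C2)" by simp
  ultimately have "81 * (k * (k - 1)) * C2 + 16 * ((k - t + 1)\<^sup>2 * C2) + 16 * (m * C2) < 16 * C1"
    using C2_le_C1 unfolding add_mult_distrib mult.assoc by linarith
  then show ?thesis using assms(1) by linarith
qed

text \<open>Passing from m to d > m raises the lower bound on \<open>c\<close> by at least
  \<open>C1 - m * C2\<close>, more than the error \<open>R\<close> permits. It is applied with
  \<open>c\<close> the size of \<open>\<F>\<close> and with \<open>c\<close> the degree of
  \<open>X\<close>.\<close>

lemma few_cover_vertices_contradiction:
  assumes m: "m < d" "m \<le> k - t + 1" and c: "(n - t) choose (k - t) \<le> c + avoiding d"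
    and up: "c + ((n - t - m) choose (k - t)) \<le> ((n - t) choose (k - t)) + R"
    and R: "R + m * C2 < C1"
  shows False
proof -
  have "avoiding d \<le> (n - t - (m + 1)) choose (k - t)" using m by (intro int_binom_le) simp
  moreover have "((n - t - (m + 1)) choose (k - t)) + C1 \<le> ((n - t - m) choose (k - t)) + m * C2"
    using nt m(2) t by (intro binomial_diff_step) linarith
  ultimately show False using c up R by linarith
qed

text \<open>As \<open>S\<close> is not a t-cover, one branching step on \<open>F\<close> leads to
  (t+2)-sets, each in at most \<open>C2\<close> members.\<close>

lemma card_containing_noncover:
  assumes "\<F> \<subseteq> nsets {1..n} k" "S \<subseteq> {1..n}" "card S = t + 1" "F \<in> \<F>" "card (F \<inter> S) < t" "t_intersecting t \<F>"
  shows "card (containing \<F> S) \<le> (k - t + 1) * C2"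
proof (rule card_containing_branch)
  show "finite \<F>" using assms(1) finite_subset finite_imp_finite_nsets by blast
  show "finite F" "card F \<le> k" using assms(1,4) by (auto simp: nsets_def)
  show "card (S \<inter> F) < t" using assms(5) by (simp add: Int_commute)
  show "t \<le> card (B \<inter> F)" if "B \<in> \<F>" for B using that assms(4,6) by (auto simp: t_intersecting_def)
  fix y assume y: "y \<in> F - S"
  have fS: "finite S" using assms(2) finite_subset by blast
  have "F \<subseteq> {1..n}" using assms(1,4) by (auto simp: nsets_def)
  then have yS: "insert y S \<subseteq> {1..n}" using y assms(2) by blast
  have "card (containing \<F> (insert y S)) \<le> card {F \<in> nsets {1..n} k. insert y S \<subseteq> F}"
    using assms(1) by (intro card_mono) (auto simp: containing_def finite_imp_finite_nsets)
  also have "\<dots> \<le> (card {1..n} - (t + 2)) choose (k - (t + 2))"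
    using assms(3) y k fS by (intro card_nsets_superset_le yS) auto
  finally show "card (containing \<F> (insert y S)) \<le> C2" by simp
qed

text \<open>\<open>F1\<close> yields k - t + 1 points that hit every member containing
  \<open>X\<close>. Such a member meets the cover vertices or contains \<open>insert y X\<close> for
  a hitting point \<open>y\<close> that is no cover vertex; then \<open>insert y X\<close> is not a
  t-cover and lies in few members.\<close>

lemma card_containing_le:
  assumes \<F>: "\<F> \<subseteq> nsets {1..n} k" "t_intersecting t \<F>" and X: "X \<in> nsets {1..n} t"
    and F1: "F1 \<in> \<F>" "\<not> X \<subseteq> F1"
  shows "card (containing \<F> X) + ((n - t - card (cover_vertices n t \<F> X)) choose (k - t))
         \<le> ((n - t) choose (k - t)) + (k - t + 1)\<^sup>2 * C2"
proof -
  let ?V = "cover_vertices n t \<F> X"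
  have X': "finite X" "card X = t" "X \<subseteq> {1..n}" using X by (auto simp: nsets_def)
  have F1': "finite F1" "card F1 = k" "F1 \<subseteq> {1..n}" using F1(1) \<F>(1) by (auto simp: nsets_def)
  have fin: "finite \<F>" using \<F>(1) finite_subset finite_imp_finite_nsets by blast
  have "X \<inter> F1 \<subset> X" using F1(2) by blast
  then have l: "card (X \<inter> F1) < t" using X' psubset_card_mono by metis
  obtain Y where Y: "Y \<subseteq> F1 - X" "finite Y" "card Y = k - t + 1"
    and hit: "\<And>B. t \<le> card (B \<inter> F1) \<Longrightarrow> B \<inter> Y \<noteq> {}"
    using hitting_set[OF F1'(1) l] F1'(2) k by auto
  let ?M = "{F \<in> nsets {1..n} k. X \<subseteq> F \<and> F \<inter> ?V \<noteq> {}}"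
  have "containing \<F> X \<subseteq> ?M \<union> (\<Union>y\<in>Y - ?V. containing \<F> (insert y X))"
  proof
    fix F assume F: "F \<in> containing \<F> X"
    then have "t \<le> card (F \<inter> F1)" using \<F>(2) F1(1) by (auto simp: containing_def t_intersecting_def)
    then have "F \<inter> Y \<noteq> {}" by (rule hit)
    then show "F \<in> ?M \<union> (\<Union>y\<in>Y - ?V. containing \<F> (insert y X))"
      using F \<F>(1) unfolding containing_def by blast
  qed
  then have "card (containing \<F> X) \<le> card (?M \<union> (\<Union>y\<in>Y - ?V. containing \<F> (insert y X)))"
    using fin Y(2) by (intro card_mono) (auto simp: containing_def finite_imp_finite_nsets)
  also have "\<dots> \<le> card ?M + card (\<Union>y\<in>Y - ?V. containing \<F> (insert y X))" by (rule card_Un_le)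
  also have "card (\<Union>y\<in>Y - ?V. containing \<F> (insert y X)) \<le> card (Y - ?V) * ((k - t + 1) * C2)"
  proof (rule card_UN_le_mult)
    fix y assume y: "y \<in> Y - ?V"
    then have yX: "y \<notin> X" "y \<in> {1..n}" using Y(1) F1'(3) by auto
    then obtain F where "F \<in> \<F>" "card (F \<inter> insert y X) < t"
      using y by (auto simp: cover_vertices_def not_le)
    then show "card (containing \<F> (insert y X)) \<le> (k - t + 1) * C2"
      using X' yX \<F> by (intro card_containing_noncover) auto
  qed (use Y in simp)
  also have "\<dots> \<le> (k - t + 1) * ((k - t + 1) * C2)"
    using Y(2,3) card_mono[OF Y(2), of "Y - ?V"] by (intro mult_right_mono) auto
  finally have "card (containing \<F> X) \<le> card ?M + (k - t + 1)\<^sup>2 * C2"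
    by (simp only: power2_eq_square mult.assoc)
  moreover have "card ?M + ((n - t - card ?V) choose (k - t)) = (n - t) choose (k - t)"
  proof -
    have "?V \<subseteq> {1..n}" "X \<inter> ?V = {}" by (auto simp: cover_vertices_def)
    then show ?thesis using card_superset_meeting[of "{1..n}" X ?V k] X' k by simp
  qed
  ultimately show ?thesis by linarith
qed

text \<open>Only d of the cover vertices are kept. Here d need not be the one of the size
  hypothesis: the extremal case uses d + 1.\<close>

lemma enough_cover_vertices:
  assumes \<F>: "\<F> \<subseteq> nsets {1..n} k" and X: "X \<in> nsets {1..n} t" and F1: "F1 \<in> \<F>" "\<not> X \<subseteq> F1"
    and d: "1 \<le> d" "d \<le> card (cover_vertices n t \<F> X)"
  shows "card (\<F> - containing \<F> X) \<le> t * ((n - t - d) choose (k - t + 1 - d))"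
proof -
  have X': "finite X" "card X = t" "X \<subseteq> {1..n}" using X by (auto simp: nsets_def)
  obtain V where V: "V \<subseteq> cover_vertices n t \<F> X" "card V = d" "finite V"
    using d(2) obtain_subset_with_card_n by metis
  have "V \<noteq> {}" using V d by auto
  have "d \<le> k - t + 1"
    using card_cover_vertices_le[OF \<F> X F1] d(2) k by simp
  moreover have V': "X \<inter> V = {}" "V \<subseteq> {1..n}" using V(1) by (auto simp: cover_vertices_def)
  moreover from V'(1) have cU: "card (X \<union> V) = t + d" using X' V by (subst card_Un_disjoint) auto
  ultimately have "card (almost_containing n k X (X \<union> V)) \<le> t * ((n - (t + d)) choose (k + 1 - (t + d)))"
    using card_almost_containing_le[of "X \<union> V" n X k] X' k by simp
  moreover have "card (\<F> - containing \<F> X) \<le> card (almost_containing n k X (X \<union> V))"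
    using not_containing_subset_almost_containing[OF \<F> X V(1) \<open>V \<noteq> {}\<close>]
    by (intro card_mono) (auto simp: almost_containing_def finite_imp_finite_nsets)
  ultimately have "card (\<F> - containing \<F> X) \<le> t * ((n - (t + d)) choose (k + 1 - (t + d)))"
    by (meson order_trans)
  moreover have "k + 1 - (t + d) = k - t + 1 - d" "n - (t + d) = n - t - d" using k by simp_all
  ultimately show ?thesis by (simp only:)
qed

text \<open>A member of \<open>family_A\<close> misses at most one point of
  \<open>Z\<close>.\<close>

lemma card_family_A_le:
  assumes "Z \<in> nsets {1..n} (t + 2)"
  shows "card (family_A n k t Z) \<le> (t + 2) * C1"
proof -
  have Z: "finite Z" "card Z = t + 2" "Z \<subseteq> {1..n}" using assms by (auto simp: nsets_def)
  have "family_A n k t Z \<subseteq> (\<Union>z\<in>Z. {F \<in> nsets {1..n} k. Z - {z} \<subseteq> F})"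
  proof
    fix F assume F: "F \<in> family_A n k t Z"
    then have "\<exists>z\<in>Z. Z - {z} \<subseteq> F" using Z by (intro Diff_singleton_subset) (auto simp: family_A_def)
    then show "F \<in> (\<Union>z\<in>Z. {F \<in> nsets {1..n} k. Z - {z} \<subseteq> F})" using F by (auto simp: family_A_def)
  qed
  then have "card (family_A n k t Z) \<le> card (\<Union>z\<in>Z. {F \<in> nsets {1..n} k. Z - {z} \<subseteq> F})"
    using Z(1) by (intro card_mono) (auto simp: finite_imp_finite_nsets)
  also have "\<dots> \<le> card Z * C1"
  proof (rule card_UN_le_mult[OF Z(1)])
    fix z assume "z \<in> Z"
    then have "card {F \<in> nsets {1..n} k. Z - {z} \<subseteq> F} \<le> (card {1..n} - (t + 1)) choose (k - (t + 1))"
      using Z k by (intro card_nsets_superset_le) auto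
    then show "card {F \<in> nsets {1..n} k. Z - {z} \<subseteq> F} \<le> C1" by simp
  qed
  finally show ?thesis using Z by simp
qed

text \<open>For d \<ge> t + 3 the size hypothesis gives \<open>(t + 3) * C1\<close> up to a small
  multiple of \<open>C2\<close>, more than the \<open>(t + 2) * C1\<close> that
  \<open>family_A\<close> can hold.\<close>

lemma large_family_A_imp_le:
  assumes "\<F> \<subseteq> family_A n k t Z" "Z \<in> nsets {1..n} (t + 2)" "large (card \<F>) d"
  shows "d \<le> t + 2"
proof (rule ccontr)
  assume d: "\<not> d \<le> t + 2"
  from d have "avoiding d \<le> (n - t - (t + 3)) choose (k - t)" by (intro int_binom_le) simp
  moreover have "((n - t - (t + 3)) choose (k - t)) + (t + 3) * C1
      \<le> ((n - t) choose (k - t)) + (t + 3) * (t + 3) * C2"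
    using nt(3) k by (intro binomial_diff_ge) linarith
  moreover have "card \<F> \<le> card (family_A n k t Z)"
    using assms(1) by (intro card_mono) (auto simp: family_A_def finite_imp_finite_nsets)
  moreover have "(t + 3) * (t + 3) * C2 < C1"
  proof (rule C2_multiple_less_C1)
    have "(t + 3) * (t + 3) \<le> (2 * k) * (2 * k)" using k by (intro mult_mono) auto
    also have "\<dots> < 7 * k\<^sup>2" using k_ge by (simp add: power2_eq_square)
    finally show "(t + 3) * (t + 3) < 7 * k\<^sup>2" .
  qed
  moreover have "(t + 3) * c = (t + 2) * c + c" for c :: nat by (simp add: algebra_simps)
  then have "(t + 3) * C1 = (t + 2) * C1 + C1" .
  ultimately show False
    using card_family_A_le[OF assms(2)] assms(3) by linarith
qed

text \<open>\<open>\<F>\<close> splits into the members containing \<open>X\<close>, bounded through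
  the cover vertices, and the few sets counted in \<open>rest\<close>. With fewer than d cover
  vertices both together are too small, and d of them confine the members not containing
  \<open>X\<close>.\<close>

lemma sunflower_case:
  assumes \<F>: "\<F> \<subseteq> nsets {1..n} k" "t_intersecting t \<F>" and X: "X \<in> nsets {1..n} t"
    and d: "1 \<le> d" and large: "large (card \<F>) d"
    and rest: "16 * card (\<F> - containing \<F> X) \<le> 81 * (k * (k - 1)) * C2"
  shows "card (\<F> - containing \<F> X) \<le> t * missing d"
proof (cases "\<exists>F\<in>\<F>. \<not> X \<subseteq> F")
  case True
  then obtain F1 where F1: "F1 \<in> \<F>" "\<not> X \<subseteq> F1" by blast
  let ?m = "card (cover_vertices n t \<F> X)"
  have m: "?m \<le> k - t + 1" using card_cover_vertices_le[OF \<F>(1) X F1] k by simp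
  have fin: "finite \<F>" using \<F>(1) finite_subset finite_imp_finite_nsets by blast
  have "containing \<F> X \<subseteq> \<F>" by (auto simp: containing_def)
  then have split: "card \<F> = card (containing \<F> X) + card (\<F> - containing \<F> X)"
    using fin by (metis card_Diff_subset card_mono finite_subset le_add_diff_inverse)
  have "d \<le> ?m"
  proof (rule ccontr)
    assume "\<not> d \<le> ?m"
    then have "?m < d" by simp
    moreover have "(n - t) choose (k - t) \<le> card \<F> + avoiding d"
      using large by (rule add_leD1)
    moreover have "card \<F> + ((n - t - ?m) choose (k - t))
        \<le> ((n - t) choose (k - t)) + (card (\<F> - containing \<F> X) + (k - t + 1)\<^sup>2 * C2)"
      using card_containing_le[OF \<F> X F1] split by linarith
    ultimately show False
      using few_cover_vertices_contradiction[OF _ m _ _ deficit_less_C1[OF rest m]] by blast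
  qed
  then show ?thesis
    using enough_cover_vertices[OF \<F>(1) X F1 d] missing_eq[of d] m by simp
next
  case False
  then have "\<F> - containing \<F> X = {}" by (auto simp: containing_def)
  then show ?thesis by (simp only: card.empty le0)
qed

text \<open>Of the at most t + 2 members of \<open>\<G>\<close>, a t-cover lies in at most
  \<open>C1\<close> members of \<open>\<F>\<close> and any other in at most
  \<open>(k - t + 1) * C2\<close>. Two covers cannot account for \<open>3 * C1 - 9 * C2\<close>
  sets, so there are three.\<close>

lemma small_simplex_case:
  assumes \<F>: "\<F> \<subseteq> nsets {1..n} k" "t_intersecting t \<F>" and Z: "Z \<in> nsets {1..n} (t + 2)"
    and \<G>: "\<And>G. G \<in> \<G> \<Longrightarrow> G \<subseteq> Z \<and> card G = t + 1"
    and rest: "16 * card {F \<in> \<F>. \<not> (\<exists>G\<in>\<G>. G \<subseteq> F)} \<le> 81 * (k * (k - 1)) * C2"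
    and large: "3 * C1 \<le> card \<F> + 9 * C2"
  shows "\<F> \<subseteq> family_A n k t Z"
proof -
  define \<C> where "\<C> = {G \<in> \<G>. \<forall>F\<in>\<F>. t \<le> card (F \<inter> G)}"
  have Z': "finite Z" "card Z = t + 2" "Z \<subseteq> {1..n}" using Z by (auto simp: nsets_def)
  have fin: "finite \<F>" using \<F>(1) finite_subset finite_imp_finite_nsets by blast
  have \<G>': "\<G> \<subseteq> {G. G \<subseteq> Z \<and> card G = t + 1}" using \<G> by blast
  have finG: "finite \<G>" by (rule finite_subset[OF \<G>']) (use Z'(1) in simp)
  have c\<G>: "card \<G> \<le> t + 2"
  proof -
    have "card \<G> \<le> card {G. G \<subseteq> Z \<and> card G = t + 1}" using \<G>' Z'(1) by (intro card_mono) auto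
    also have "\<dots> = t + 2" using Z' by (simp add: n_subsets)
    finally show ?thesis .
  qed
  have finC: "finite \<C>" using finG by (simp add: \<C>_def)
  have "2 < card \<C>"
  proof (rule ccontr)
    assume "\<not> 2 < card \<C>"
    then have c2: "card \<C> \<le> 2" by simp
    let ?rest = "{F \<in> \<F>. \<not> (\<exists>G\<in>\<G>. G \<subseteq> F)}"
    have "\<F> \<subseteq> ?rest \<union> ((\<Union>G\<in>\<C>. containing \<F> G) \<union> (\<Union>G\<in>\<G> - \<C>. containing \<F> G))"
    proof
      fix F assume F: "F \<in> \<F>"
      show "F \<in> ?rest \<union> ((\<Union>G\<in>\<C>. containing \<F> G) \<union> (\<Union>G\<in>\<G> - \<C>. containing \<F> G))"
      proof (cases "\<exists>G\<in>\<G>. G \<subseteq> F")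
        case True
        then obtain G where "G \<in> \<G>" "F \<in> containing \<F> G" using F by (auto simp: containing_def)
        then show ?thesis by (cases "G \<in> \<C>") auto
      qed (use F in simp)
    qed
    then have "card \<F> \<le> card (?rest \<union> ((\<Union>G\<in>\<C>. containing \<F> G) \<union> (\<Union>G\<in>\<G> - \<C>. containing \<F> G)))"
      using fin finG finC by (intro card_mono) (auto simp: containing_def)
    also have "\<dots> \<le> card ?rest + card ((\<Union>G\<in>\<C>. containing \<F> G) \<union> (\<Union>G\<in>\<G> - \<C>. containing \<F> G))"
      by (rule card_Un_le)
    also have "card ((\<Union>G\<in>\<C>. containing \<F> G) \<union> (\<Union>G\<in>\<G> - \<C>. containing \<F> G))
        \<le> card (\<Union>G\<in>\<C>. containing \<F> G) + card (\<Union>G\<in>\<G> - \<C>. containing \<F> G)"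
      by (rule card_Un_le)
    also have "card (\<Union>G\<in>\<C>. containing \<F> G) \<le> card \<C> * C1"
    proof (rule card_UN_le_mult[OF finC])
      fix G assume "G \<in> \<C>"
      then have G: "G \<subseteq> {1..n}" "card G = t + 1" using \<G>[of G] Z'(3) by (auto simp: \<C>_def)
      have "card (containing \<F> G) \<le> card {F \<in> nsets {1..n} k. G \<subseteq> F}"
        using \<F>(1) by (intro card_mono) (auto simp: containing_def finite_imp_finite_nsets)
      also have "\<dots> \<le> (card {1..n} - (t + 1)) choose (k - (t + 1))"
        using G k by (intro card_nsets_superset_le) auto
      finally show "card (containing \<F> G) \<le> C1" by simp
    qed
    also have "\<dots> \<le> 2 * C1" using c2 by (rule mult_right_mono) simp
    also have "card (\<Union>G\<in>\<G> - \<C>. containing \<F> G) \<le> card (\<G> - \<C>) * ((k - t + 1) * C2)"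
    proof (rule card_UN_le_mult)
      fix G assume G: "G \<in> \<G> - \<C>"
      then obtain F where "F \<in> \<F>" "card (F \<inter> G) < t" by (auto simp: \<C>_def not_le)
      then show "card (containing \<F> G) \<le> (k - t + 1) * C2"
        using G \<G>[of G] Z'(3) \<F> by (intro card_containing_noncover) auto
    qed (use finG in simp)
    also have "\<dots> \<le> k * ((k - 1) * C2)"
    proof (rule mult_mono)
      have "card (\<G> - \<C>) \<le> card \<G>" using finG by (intro card_mono) auto
      then show "card (\<G> - \<C>) \<le> k" using c\<G> k by linarith
      show "(k - t + 1) * C2 \<le> (k - 1) * C2" using k t by (intro mult_right_mono) auto
    qed auto
    finally have "card \<F> \<le> card ?rest + (2 * C1 + k * (k - 1) * C2)"
      by (simp only: mult.assoc add_le_cancel_left)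
    then have "C1 \<le> card ?rest + k * (k - 1) * C2 + 9 * C2" using large by linarith
    \<comment> \<open>97 = 81 + 16 collects the exceptional sets and the non-covers, 144 = 16 * 9
      the error in \<open>large\<close>.\<close>
    then have "16 * C1 \<le> (97 * (k * (k - 1)) + 144) * C2"
      using rest unfolding add_mult_distrib mult.assoc by linarith
    moreover have "97 * (k * (k - 1)) + 144 < 112 * k\<^sup>2"
    proof -
      obtain j where j: "k = j + 4" using k_ge by (metis le_add_diff_inverse2)
      then have "k * (k - 1) = (j + 4) * (j + 3)" "k\<^sup>2 = (j + 4) * (j + 4)"
        by (simp_all add: power2_eq_square)
      then show ?thesis by (simp add: algebra_simps)
    qed
    then have "(97 * (k * (k - 1)) + 144) * C2 < 112 * k\<^sup>2 * C2"
      using C2_pos by (rule mult_strict_right_mono)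
    moreover have "112 * k\<^sup>2 * C2 = 16 * (7 * k\<^sup>2 * C2)" by simp
    ultimately show False using C2_le_C1 by linarith
  qed
  then show ?thesis
  proof (rule subset_family_A_of_three_covers[OF Z'(1,2) finC _ _ _ \<F>(1)])
    show "G \<subseteq> Z \<and> card G = t + 1" if "G \<in> \<C>" for G using that \<G> by (simp add: \<C>_def)
    show "t \<le> card (F \<inter> G)" if "G \<in> \<C>" "F \<in> \<F>" for G F using that by (simp add: \<C>_def)
  qed
qed

lemma dichotomy:
  assumes \<F>: "\<F> \<subseteq> nsets {1..n} k" "t_intersecting t \<F>" and d: "2 \<le> d" and large: "large (card \<F>) d"
  shows "(\<exists>X\<in>nsets {1..n} t. card (\<F> - containing \<F> X) \<le> t * missing d) \<or>
    d \<le> t + 2 \<and> (\<exists>Z\<in>nsets {1..n} (t + 2). \<F> \<subseteq> family_A n k t Z)"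
proof -
  have "t + 1 \<le> k" using k by simp
  from peel[OF _ \<F> this] obtain \<G> where \<G>: "\<G> \<subseteq> Pow {1..n}" "t_intersecting t \<G>"
    "\<And>G. G \<in> \<G> \<Longrightarrow> card G \<le> t + 1"
    and "card {F \<in> \<F>. \<not> (\<exists>G\<in>\<G>. G \<subseteq> F)} \<le> (\<Sum>s\<in>{t + 1<..k}. weight s)" by auto
  then have rest: "16 * card {F \<in> \<F>. \<not> (\<exists>G\<in>\<G>. G \<subseteq> F)} \<le> 81 * (k * (k - 1)) * C2"
    using sum_weight_le_C2 by linarith
  have fin: "finite \<F>" using \<F>(1) finite_subset finite_imp_finite_nsets by blast
  have "t \<le> card {1..n}" using nt by simp
  from t_intersecting_structure[OF _ this \<G>]
  consider X where "X \<subseteq> {1..n}" "card X = t" "\<forall>G\<in>\<G>. X \<subseteq> G"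
    | Z where "Z \<subseteq> {1..n}" "card Z = t + 2" "\<forall>G\<in>\<G>. G \<subseteq> Z \<and> card G = t + 1" by blast
  then show ?thesis
  proof cases
    case 1
    then have X: "X \<in> nsets {1..n} t" by (auto simp: nsets_def finite_subset)
    \<comment> \<open>Each \<open>G\<close> contains \<open>X\<close>, so a member of
      \<open>\<F>\<close> not containing \<open>X\<close> lies above no \<open>G\<close> and is
      exceptional.\<close>
    have "card (\<F> - containing \<F> X) \<le> card {F \<in> \<F>. \<not> (\<exists>G\<in>\<G>. G \<subseteq> F)}"
      using 1(3) fin by (intro card_mono) (auto simp: containing_def)
    then have "16 * card (\<F> - containing \<F> X) \<le> 81 * (k * (k - 1)) * C2" using rest by linarith
    then have "card (\<F> - containing \<F> X) \<le> t * missing d"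
      using d by (intro sunflower_case \<F> X large) auto
    then show ?thesis using X by blast
  next
    case 2
    then have Z: "Z \<in> nsets {1..n} (t + 2)" by (auto simp: nsets_def finite_subset)
    have "\<F> \<subseteq> family_A n k t Z"
      using 2 by (intro small_simplex_case[OF \<F> Z _ rest large_imp_ge[OF d large]]) auto
    then show ?thesis using large_family_A_imp_le[OF _ Z large] Z by blast
  qed
qed

end

section \<open>The extremal families\<close>

lemma family_L_eq:
  assumes "X \<inter> V = {}"
  shows "family_L n k X (X \<union> V) (X \<union> V)
       = {F \<in> nsets {1..n} k. X \<subseteq> F \<and> F \<inter> V \<noteq> {}} \<union> almost_containing n k X (X \<union> V)"
proof -
  have "X \<union> V - X = V" using assms by blast
  then show ?thesis by (simp add: family_L_def almost_containing_def)
qed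

context large_ground_set
begin

text \<open>Equality leaves exactly d cover vertices, and the members not containing
  \<open>X\<close> fill all of \<open>almost_containing\<close>. This forces every member containing
  \<open>X\<close> to meet the cover vertices, and the size hypothesis makes all such k-sets
  members.\<close>

lemma extremal_family:
  assumes \<F>: "\<F> \<subseteq> nsets {1..n} k" "t_intersecting t \<F>" and X: "X \<in> nsets {1..n} t"
    and d: "1 \<le> d" "d \<le> k - t + 1" and large: "large (card \<F>) d"
    and eq: "card (\<F> - containing \<F> X) = t * missing d"
  shows "\<exists>V. V \<subseteq> {1..n} - X \<and> card V = d \<and> \<F> = family_L n k X (X \<union> V) (X \<union> V)"
proof -
  let ?V = "cover_vertices n t \<F> X"
  let ?m = "card ?V"
  have X': "finite X" "card X = t" "X \<subseteq> {1..n}" using X by (auto simp: nsets_def)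
  have fin: "finite \<F>" using \<F>(1) finite_subset finite_imp_finite_nsets by blast
  have V: "?V \<subseteq> {1..n}" "X \<inter> ?V = {}" by (auto simp: cover_vertices_def)
  have finV: "finite ?V" using V(1) finite_subset by blast
  have a: "avoiding d = (n - t - d) choose (k - t)" and m: "missing d = (n - t - d) choose (k - t + 1 - d)"
    using d(2) by (rule avoiding_eq, rule missing_eq)
  have room: "84 * k \<le> n" by (rule n_ge)
  have "0 < missing d" unfolding m using room k by (intro zero_less_binomial) linarith
  then have "0 < card (\<F> - containing \<F> X)" unfolding eq using t by simp
  then obtain F1 where F1: "F1 \<in> \<F>" "\<not> X \<subseteq> F1" by (auto simp: card_gt_0_iff containing_def)
  have m_le: "?m \<le> k - t + 1" using card_cover_vertices_le[OF \<F>(1) X F1] k by simp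
  have sub: "containing \<F> X \<subseteq> \<F>" by (auto simp: containing_def)
  then have split: "card \<F> = card (containing \<F> X) + card (\<F> - containing \<F> X)"
    using fin by (metis card_Diff_subset card_mono finite_subset le_add_diff_inverse)
  \<comment> \<open>Equality cancels \<open>t * missing d\<close> in the size hypothesis and leaves
    a bound on the degree of \<open>X\<close> alone.\<close>
  then have deg: "(n - t) choose (k - t) \<le> card (containing \<F> X) + avoiding d"
    using large eq by linarith
  have d_le: "d \<le> ?m"
  proof (rule ccontr)
    assume "\<not> d \<le> ?m"
    then have "?m < d" by simp
    moreover have "0 + (k - t + 1)\<^sup>2 * C2 + ?m * C2 < C1" by (rule deficit_less_C1[OF _ m_le]) simp
    ultimately show False
      using few_cover_vertices_contradiction[OF _ m_le deg card_containing_le[OF \<F> X F1]] by simp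
  qed
  have m_eq: "?m = d"
  proof (rule ccontr)
    assume "?m \<noteq> d"
    then have d1: "d + 1 \<le> ?m" using d_le by simp
    then have "card (\<F> - containing \<F> X) \<le> t * ((n - t - (d + 1)) choose (k - t + 1 - (d + 1)))"
      by (intro enough_cover_vertices[OF \<F>(1) X F1]) simp
    \<comment> \<open>Pascal's rule; the second summand is positive, so d + 1 cover vertices would
      allow strictly fewer sets.\<close>
    moreover have "missing d = ((n - t - (d + 1)) choose (k - t + 1 - (d + 1)))
        + ((n - t - (d + 1)) choose (k - t + 1 - d))"
    proof -
      have "0 < n - t - d" "0 < k - t + 1 - d" using room d1 m_le k by linarith+
      then show ?thesis using choose_reduce_nat[of "n - t - d" "k - t + 1 - d"] unfolding m by simp
    qed
    moreover have "0 < (n - t - (d + 1)) choose (k - t + 1 - d)"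
      using room d k by (intro zero_less_binomial) linarith
    ultimately have "(n - t - (d + 1)) choose (k - t + 1 - (d + 1)) < missing d" by linarith
    then have "t * ((n - t - (d + 1)) choose (k - t + 1 - (d + 1))) < t * missing d"
      using t by (intro mult_strict_left_mono) auto
    then show False using eq \<open>card (\<F> - containing \<F> X) \<le> _\<close> by linarith
  qed
  have neV: "?V \<noteq> {}" using m_eq d(1) by auto
  have cU: "card (X \<union> ?V) = t + d" using X' finV V m_eq by (subst card_Un_disjoint) auto
  have "k + 1 - (t + d) = k - t + 1 - d" "n - (t + d) = n - t - d" using k by simp_all
  then have "card (almost_containing n k X (X \<union> ?V)) \<le> t * missing d"
    using card_almost_containing_le[of "X \<union> ?V" n X k] X' V cU d k unfolding m by simp
  then have almost: "\<F> - containing \<F> X = almost_containing n k X (X \<union> ?V)"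
    using not_containing_subset_almost_containing[OF \<F>(1) X subset_refl neV] eq
    by (intro card_seteq) (auto simp: almost_containing_def finite_imp_finite_nsets)
  let ?M = "{F \<in> nsets {1..n} k. X \<subseteq> F \<and> F \<inter> ?V \<noteq> {}}"
  have "containing \<F> X \<subseteq> ?M"
  proof
    fix F assume F: "F \<in> containing \<F> X"
    then have F': "F \<in> \<F>" "X \<subseteq> F" "F \<subseteq> {1..n}" "finite F" "card F = k"
      using \<F>(1) by (auto simp: containing_def nsets_def)
    have "F \<inter> ?V \<noteq> {}"
    proof
      assume dis: "F \<inter> ?V = {}"
      obtain x where x: "x \<in> X" using X' t by fastforce
      have "card (F \<union> ?V) \<le> k + d" using card_Un_le[of F ?V] F' m_eq by simp
      moreover have "card ({1..n} - (F \<union> ?V)) = n - card (F \<union> ?V)"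
        using F' V(1) finV by (subst card_Diff_subset) auto
      ultimately have "k + 1 - t - d \<le> card ({1..n} - (F \<union> ?V))" using room d k by linarith
      then obtain W where W: "W \<subseteq> {1..n} - (F \<union> ?V)" "card W = k + 1 - t - d" "finite W"
        using obtain_subset_with_card_n by metis
      \<comment> \<open>\<open>W\<close> avoids \<open>F\<close> and fills \<open>?F\<close> up to k
        points, so \<open>?F\<close> lies in \<open>almost_containing\<close> and meets
        \<open>F\<close> only in the t - 1 points of \<open>X - {x}\<close>.\<close>
      let ?F = "(X - {x}) \<union> ?V \<union> W"
      have c1: "card ((X - {x}) \<union> ?V) = t - 1 + d"
        using X' V finV x m_eq by (subst card_Un_disjoint) auto
      have "((X - {x}) \<union> ?V) \<inter> W = {}" using W F'(2) by blast
      then have "card ?F = t - 1 + d + (k + 1 - t - d)"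
        using c1 X' finV W by (subst card_Un_disjoint) auto
      then have "card ?F = k" using t d k by simp
      moreover have "?F \<inter> (X \<union> ?V) = X \<union> ?V - {x}" using x V(2) W F'(2) by blast
      ultimately have "?F \<in> almost_containing n k X (X \<union> ?V)"
        using X' V(1) finV W x by (auto simp: almost_containing_def nsets_def)
      then have "?F \<in> \<F>" using almost by blast
      then have "t \<le> card (F \<inter> ?F)" using \<F>(2) F'(1) by (auto simp: t_intersecting_def)
      moreover have "F \<inter> ?F = X - {x}" using F'(2) dis W by blast
      ultimately show False using X' x t by simp
    qed
    then show "F \<in> ?M" using F' \<F>(1) by auto
  qed
  moreover have "card ?M + ((n - t - d) choose (k - t)) = (n - t) choose (k - t)"
    using card_superset_meeting[of "{1..n}" X ?V k] X' V m_eq k by simp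
  then have "card ?M \<le> card (containing \<F> X)" using deg unfolding a by linarith
  ultimately have "containing \<F> X = ?M"
    by (intro card_seteq) (auto simp: finite_imp_finite_nsets)
  moreover have "\<F> = containing \<F> X \<union> (\<F> - containing \<F> X)" using sub by (simp add: Un_absorb1)
  ultimately have "\<F> = family_L n k X (X \<union> ?V) (X \<union> ?V)"
    unfolding family_L_eq[OF V(2)] using almost by (simp only:)
  moreover have "?V \<subseteq> {1..n} - X" unfolding cover_vertices_def by (rule Collect_restrict)
  ultimately show ?thesis using m_eq by blast
qed

text \<open>Needed for the converse in the equality case: no t-set has larger degree than
  \<open>X\<close>, whose degree is the number of k-sets containing \<open>X\<close> and meeting
  \<open>V\<close>.\<close>

lemma degree_family_L_le:
  assumes X: "X \<in> nsets {1..n} t" and V: "V \<subseteq> {1..n} - X" "card V = d"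
    and d: "2 \<le> d" "d \<le> k - t + 1" and S: "S \<in> nsets {1..n} t"
  shows "card (containing (family_L n k X (X \<union> V) (X \<union> V)) S) + avoiding d \<le> (n - t) choose (k - t)"
proof -
  let ?L = "family_L n k X (X \<union> V) (X \<union> V)"
  have X': "finite X" "card X = t" "X \<subseteq> {1..n}" and S': "finite S" "card S = t" "S \<subseteq> {1..n}"
    using X S by (auto simp: nsets_def)
  have V': "finite V" "X \<inter> V = {}" "V \<subseteq> {1..n}" using V(1) finite_subset by auto
  have U: "X \<union> V \<subseteq> {1..n}" using X' V' by blast
  have cU: "card (X \<union> V) = t + d" using X' V' V(2) by (subst card_Un_disjoint) auto
  have L: "?L = {F \<in> nsets {1..n} k. X \<subseteq> F \<and> F \<inter> V \<noteq> {}} \<union> almost_containing n k X (X \<union> V)"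
    by (rule family_L_eq[OF V'(2)])
  have a: "avoiding d = (n - t - d) choose (k - t)" using d(2) by (rule avoiding_eq)
  have avoid2: "avoiding d + 2 * C1 \<le> ((n - t) choose (k - t)) + 4 * C2"
  proof -
    have "avoiding d \<le> (n - t - 2) choose (k - t)" using d by (intro int_binom_le) simp
    moreover have "((n - t - 2) choose (k - t)) + 2 * C1 \<le> ((n - t) choose (k - t)) + 2 * 2 * C2"
      using nt by (intro binomial_diff_ge) linarith
    ultimately show ?thesis by linarith
  qed
  have small: "(m + 4) * C2 < C1" if "m \<le> k" for m
  proof (rule C2_multiple_less_C1)
    have "m + 4 \<le> 2 * k" using that k_ge by simp
    also have "\<dots> < 7 * k\<^sup>2" using k_ge by (simp add: power2_eq_square)
    finally show "m + 4 < 7 * k\<^sup>2" .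
  qed
  show ?thesis
  proof (cases "S \<subseteq> X \<union> V \<and> d = 2 \<or> S = X")
    \<comment> \<open>For d = 2 the family is \<open>family_A\<close> of
      \<open>X \<union> V\<close>, symmetric in all t-subsets of \<open>X \<union> V\<close>, so
      these are treated like \<open>X\<close>.\<close>
    case True
    have "containing ?L S \<subseteq> {F \<in> nsets {1..n} k. S \<subseteq> F \<and> F \<inter> (X \<union> V - S) \<noteq> {}}
        \<and> card (X \<union> V - S) = d"
    proof -
      have SU: "S \<subseteq> X \<union> V" using True by blast
      have c: "card (X \<union> V - S) = d" using SU S' cU by (subst card_Diff_subset) auto
      have "F \<inter> (X \<union> V - S) \<noteq> {}" if F: "F \<in> ?L" "S \<subseteq> F" for F
      proof
        assume dis: "F \<inter> (X \<union> V - S) = {}"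
        then have FU: "F \<inter> (X \<union> V) = S" using F(2) SU by blast
        consider "X \<subseteq> F" "F \<inter> V \<noteq> {}" | x where "x \<in> X" "F \<inter> (X \<union> V) = X \<union> V - {x}"
          using F(1) unfolding L by (auto simp: almost_containing_def)
        then show False
        proof cases
          case 1
          then have "X \<subset> S" using FU V'(2) by blast
          then have "card X < card S" using S'(1) by (rule psubset_card_mono[rotated])
          then show False using X' S' by simp
        next
          case 2
          then have "S = X \<union> V - {x}" using FU by simp
          then have "card S = t + d - 1" using 2(1) cU X' V' by simp
          then show False using S' d by simp
        qed
      qed
      moreover have "F \<in> nsets {1..n} k" if "F \<in> ?L" for F
        using that unfolding L by (auto simp: almost_containing_def)
      ultimately show ?thesis using c by (auto simp: containing_def)
    qed
    then have "card (containing ?L S) \<le> card {F \<in> nsets {1..n} k. S \<subseteq> F \<and> F \<inter> (X \<union> V - S) \<noteq> {}}"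
      "card (X \<union> V - S) = d"
      by (auto intro!: card_mono simp: finite_imp_finite_nsets)
    moreover have "card {F \<in> nsets {1..n} k. S \<subseteq> F \<and> F \<inter> (X \<union> V - S) \<noteq> {}}
        + ((n - t - card (X \<union> V - S)) choose (k - t)) = (n - t) choose (k - t)"
      using card_superset_meeting[of "{1..n}" S "X \<union> V - S" k] S' U k by auto
    ultimately show ?thesis unfolding a by simp
  next
    case False
    \<comment> \<open>Every other t-set has degree at most about \<open>C1\<close>, while
      \<open>avoid2\<close> leaves room for nearly \<open>2 * C1\<close>. The second alternative
      covers d = 2, the first d \<ge> 3.\<close>
    have bound: "card (containing ?L S) \<le> C1 + t * C2 \<or> card (containing ?L S) \<le> (t + 2) * C2"
    proof (cases "d = 2")
      case True
      then have "\<not> S \<subseteq> X \<union> V" using False by blast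
      then obtain s where s: "s \<in> S" "s \<notin> X \<union> V" by blast
      \<comment> \<open>\<open>s\<close> and all but one point of \<open>X \<union> V\<close> make t
        + 2 prescribed points.\<close>
      have "containing ?L S \<subseteq> (\<Union>z\<in>X \<union> V. {F \<in> nsets {1..n} k. insert s (X \<union> V - {z}) \<subseteq> F})"
      proof
        fix F assume F: "F \<in> containing ?L S"
        then have F': "F \<in> nsets {1..n} k" "s \<in> F" using s
          unfolding L by (auto simp: containing_def almost_containing_def)
        have "\<exists>z\<in>X \<union> V. X \<union> V - {z} \<subseteq> F"
        proof -
          consider "X \<subseteq> F" "F \<inter> V \<noteq> {}" | x where "x \<in> X" "F \<inter> (X \<union> V) = X \<union> V - {x}"
            using F unfolding L by (auto simp: almost_containing_def containing_def)
          then show ?thesis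
          proof cases
            case 1
            then obtain v where v: "v \<in> V" "v \<in> F" by blast
            have "card (V - {v}) = 1" using v V V' True by simp
            then obtain w where "V - {v} = {w}" by (auto simp: card_1_singleton_iff)
            then have "w \<in> V" "X \<union> V - {w} \<subseteq> F" using 1 v by blast+
            then show ?thesis by blast
          qed blast
        qed
        then show "F \<in> (\<Union>z\<in>X \<union> V. {F \<in> nsets {1..n} k. insert s (X \<union> V - {z}) \<subseteq> F})"
          using F' by blast
      qed
      then have "card (containing ?L S)
          \<le> card (\<Union>z\<in>X \<union> V. {F \<in> nsets {1..n} k. insert s (X \<union> V - {z}) \<subseteq> F})"
        using X' V' by (intro card_mono) (auto simp: finite_imp_finite_nsets)
      also have "\<dots> \<le> card (X \<union> V) * C2"
      proof (rule card_UN_le_mult)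
        fix z assume z: "z \<in> X \<union> V"
        have "card (insert s (X \<union> V - {z})) = t + 2"
          using s z X' V' cU True by (subst card_insert_disjoint) auto
        then have "card {F \<in> nsets {1..n} k. insert s (X \<union> V - {z}) \<subseteq> F}
            \<le> (card {1..n} - (t + 2)) choose (k - (t + 2))"
          using U s S' k by (intro card_nsets_superset_le) auto
        then show "card {F \<in> nsets {1..n} k. insert s (X \<union> V - {z}) \<subseteq> F} \<le> C2" by simp
      qed (use X' V' in simp)
      finally show ?thesis using cU True by simp
    next
      case d3: False
      have "S \<noteq> X" using False by blast
      then obtain s where s: "s \<in> S" "s \<notin> X"
        using S' X' by (metis card_subset_eq subsetI)
      have "containing ?L S \<subseteq> {F \<in> nsets {1..n} k. insert s X \<subseteq> F}
          \<union> (\<Union>x\<in>X. {F \<in> nsets {1..n} k. X \<union> V - {x} \<subseteq> F})"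
      proof
        fix F assume F: "F \<in> containing ?L S"
        then have F': "F \<in> nsets {1..n} k" "s \<in> F" using s
          unfolding L by (auto simp: containing_def almost_containing_def)
        consider "X \<subseteq> F" "F \<inter> V \<noteq> {}" | x where "x \<in> X" "F \<inter> (X \<union> V) = X \<union> V - {x}"
          using F unfolding L by (auto simp: almost_containing_def containing_def)
        then show "F \<in> {F \<in> nsets {1..n} k. insert s X \<subseteq> F}
            \<union> (\<Union>x\<in>X. {F \<in> nsets {1..n} k. X \<union> V - {x} \<subseteq> F})"
          by cases (use F' in blast)+
      qed
      then have "card (containing ?L S) \<le> card ({F \<in> nsets {1..n} k. insert s X \<subseteq> F}
          \<union> (\<Union>x\<in>X. {F \<in> nsets {1..n} k. X \<union> V - {x} \<subseteq> F}))"
        using X' by (intro card_mono) (auto simp: finite_imp_finite_nsets)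
      also have "\<dots> \<le> card {F \<in> nsets {1..n} k. insert s X \<subseteq> F}
          + card (\<Union>x\<in>X. {F \<in> nsets {1..n} k. X \<union> V - {x} \<subseteq> F})" by (rule card_Un_le)
      also have "card {F \<in> nsets {1..n} k. insert s X \<subseteq> F} \<le> (card {1..n} - (t + 1)) choose (k - (t + 1))"
        using s S' X' k by (intro card_nsets_superset_le) auto
      also have "(card {1..n} - (t + 1)) choose (k - (t + 1)) = C1" by simp
      also have "card (\<Union>x\<in>X. {F \<in> nsets {1..n} k. X \<union> V - {x} \<subseteq> F}) \<le> card X * C2"
      proof (rule card_UN_le_mult[OF X'(1)])
        fix x assume x: "x \<in> X"
        have "card (X \<union> V - {x}) = t + d - 1" using x X' V' cU by simp
        then have "t + 2 \<le> card (X \<union> V - {x})" using d d3 by simp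
        then have "card {F \<in> nsets {1..n} k. X \<union> V - {x} \<subseteq> F}
            \<le> (card {1..n} - (t + 2)) choose (k - (t + 2))"
          using U k by (intro card_nsets_superset_le) auto
        then show "card {F \<in> nsets {1..n} k. X \<union> V - {x} \<subseteq> F} \<le> C2" by simp
      qed
      finally show ?thesis using X' by simp
    qed
    have "(t + 4) * C2 < C1" "(t + 2 + 4) * C2 < C1" using small[of t] small[of "t + 2"] k by simp_all
    then have "t * C2 + 4 * C2 < C1" "(t + 2) * C2 + 4 * C2 < C1"
      unfolding add_mult_distrib by linarith+
    then show ?thesis using bound avoid2 by linarith
  qed
qed

end

section \<open>Permutations of the ground set\<close>

lemma image_nsets_iff:
  assumes "\<pi> permutes {1..n}"
  shows "\<pi> ` F \<in> nsets {1..n} k \<longleftrightarrow> F \<in> nsets {1..n} k"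
proof -
  have i: "inj \<pi>" and A: "\<pi> ` {1..n} = {1..n}"
    using assms by (rule permutes_inj, rule permutes_image)
  have "\<pi> ` F \<subseteq> {1..n} \<longleftrightarrow> F \<subseteq> {1..n}" using i A by (metis inj_image_subset_iff)
  moreover have "finite (\<pi> ` F) \<longleftrightarrow> finite F" using i by (meson finite_image_iff inj_on_subset subset_UNIV)
  moreover have "card (\<pi> ` F) = card F" using i by (meson card_image inj_on_subset subset_UNIV)
  ultimately show ?thesis by (simp add: nsets_def)
qed

lemma image_family_L:
  assumes \<pi>: "\<pi> permutes {1..n}"
  shows "(\<lambda>F. \<pi> ` F) ` family_L n k X U V = family_L n k (\<pi> ` X) (\<pi> ` U) (\<pi> ` V)"
proof -
  have i: "inj \<pi>" using \<pi> by (rule permutes_inj)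
  have iff: "\<pi> ` F \<in> family_L n k (\<pi> ` X) (\<pi> ` U) (\<pi> ` V) \<longleftrightarrow> F \<in> family_L n k X U V" for F
  proof -
    have "\<pi> ` F \<in> nsets {1..n} k \<longleftrightarrow> F \<in> nsets {1..n} k" by (rule image_nsets_iff[OF \<pi>])
    moreover have "\<pi> ` X \<subseteq> \<pi> ` F \<longleftrightarrow> X \<subseteq> F" by (rule inj_image_subset_iff[OF i])
    moreover have "\<pi> ` F \<inter> (\<pi> ` V - \<pi> ` X) = \<pi> ` (F \<inter> (V - X))"
      by (simp add: image_Int[OF i] image_set_diff[OF i])
    then have "\<pi> ` F \<inter> (\<pi> ` V - \<pi> ` X) \<noteq> {} \<longleftrightarrow> F \<inter> (V - X) \<noteq> {}" by simp
    moreover have "\<pi> ` F \<inter> \<pi> ` U = \<pi> ` U - {\<pi> x} \<longleftrightarrow> F \<inter> U = U - {x}" for x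
    proof -
      have "\<pi> ` F \<inter> \<pi> ` U = \<pi> ` (F \<inter> U)" by (simp add: image_Int[OF i])
      moreover have "\<pi> ` U - {\<pi> x} = \<pi> ` (U - {x})" by (simp add: image_set_diff[OF i])
      ultimately show ?thesis by (simp add: inj_image_eq_iff[OF i])
    qed
    ultimately show ?thesis by (simp add: family_L_def)
  qed
  show ?thesis
  proof
    show "(\<lambda>F. \<pi> ` F) ` family_L n k X U V \<subseteq> family_L n k (\<pi> ` X) (\<pi> ` U) (\<pi> ` V)"
      using iff by blast
    show "family_L n k (\<pi> ` X) (\<pi> ` U) (\<pi> ` V) \<subseteq> (\<lambda>F. \<pi> ` F) ` family_L n k X U V"
    proof
      fix G assume G: "G \<in> family_L n k (\<pi> ` X) (\<pi> ` U) (\<pi> ` V)"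
      have "G = \<pi> ` (\<pi> -` G)" using permutes_surj[OF \<pi>] by (simp add: surj_image_vimage_eq)
      then show "G \<in> (\<lambda>F. \<pi> ` F) ` family_L n k X U V" using iff[of "\<pi> -` G"] G by (metis imageI)
    qed
  qed
qed

text \<open>The complements have equal size too, so three bijections can be glued together and
  extended by the identity outside \<open>A\<close>.\<close>

lemma ex_permutes_image_pair:
  assumes A: "finite A" and "X \<subseteq> A" "V \<subseteq> A" "X \<inter> V = {}" "X' \<subseteq> A" "V' \<subseteq> A" "X' \<inter> V' = {}"
    and c: "card X = card X'" "card V = card V'"
  shows "\<exists>\<pi>. \<pi> permutes A \<and> \<pi> ` X = X' \<and> \<pi> ` V = V'"
proof -
  have fin: "finite X" "finite V" "finite X'" "finite V'" using assms finite_subset by blast+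
  obtain f where f: "bij_betw f X X'" using finite_same_card_bij[OF fin(1,3) c(1)] by blast
  obtain g where g: "bij_betw g V V'" using finite_same_card_bij[OF fin(2,4) c(2)] by blast
  have "card (A - (X \<union> V)) = card (A - (X' \<union> V'))"
    using assms fin by (simp add: card_Diff_subset card_Un_disjoint)
  then obtain h where h: "bij_betw h (A - (X \<union> V)) (A - (X' \<union> V'))"
    using finite_same_card_bij A by (metis finite_Diff)
  define \<pi> where "\<pi> x = (if x \<in> X then f x else if x \<in> V then g x else if x \<in> A then h x else x)" for x
  have X: "bij_betw \<pi> X X'" by (rule bij_betw_cong[THEN iffD1, OF _ f]) (simp add: \<pi>_def)
  have V: "bij_betw \<pi> V V'" by (rule bij_betw_cong[THEN iffD1, OF _ g]) (use assms in \<open>auto simp: \<pi>_def\<close>)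
  have R: "bij_betw \<pi> (A - (X \<union> V)) (A - (X' \<union> V'))"
    by (rule bij_betw_cong[THEN iffD1, OF _ h]) (auto simp: \<pi>_def)
  have "bij_betw \<pi> ((X \<union> V) \<union> (A - (X \<union> V))) ((X' \<union> V') \<union> (A - (X' \<union> V')))"
    by (intro bij_betw_combine X V R) (use assms in auto)
  moreover have "(X \<union> V) \<union> (A - (X \<union> V)) = A" "(X' \<union> V') \<union> (A - (X' \<union> V')) = A"
    using assms by blast+
  ultimately have "bij_betw \<pi> A A" by simp
  then have "\<pi> permutes A"
    by (rule bij_imp_permutes) (use assms in \<open>auto simp: \<pi>_def\<close>)
  then show ?thesis using X V by (auto simp: bij_betw_def)
qed

text \<open>Trades the permutation for the pair \<open>X\<close>, \<open>V\<close> that it carries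
  to \<open>{1..t}\<close> and \<open>{t + 1..t + d}\<close>; \<open>t + d \<le> n\<close> keeps
  these inside the ground set.\<close>

lemma isomorphic_canonical_L_iff:
  assumes "t + d \<le> n"
  shows "isomorphic n \<F> (canonical_L n k t d d) \<longleftrightarrow>
    (\<exists>X V. X \<in> nsets {1..n} t \<and> V \<subseteq> {1..n} - X \<and> card V = d \<and> \<F> = family_L n k X (X \<union> V) (X \<union> V))"
    (is "?L \<longleftrightarrow> ?R")
proof
  have split: "{1..t + d} = {1..t} \<union> {t + 1..t + d}" by auto
  {
    assume ?L
    then obtain \<pi> where \<pi>: "\<pi> permutes {1..n}" "canonical_L n k t d d = (\<lambda>F. \<pi> ` F) ` \<F>"
      by (auto simp: isomorphic_def)
    let ?\<rho> = "inv \<pi>"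
    have \<rho>: "?\<rho> permutes {1..n}" using \<pi>(1) by (rule permutes_inv)
    have i: "inj ?\<rho>" using \<rho> by (rule permutes_inj)
    have "(\<lambda>F. ?\<rho> ` F) ` canonical_L n k t d d = \<F>"
      unfolding \<pi>(2) by (simp add: image_image permutes_inverses(2)[OF \<pi>(1)])
    then have "\<F> = family_L n k (?\<rho> ` {1..t}) (?\<rho> ` {1..t} \<union> ?\<rho> ` {t + 1..t + d})
        (?\<rho> ` {1..t} \<union> ?\<rho> ` {t + 1..t + d})"
      unfolding canonical_L_def image_family_L[OF \<rho>] split image_Un by (rule sym)
    moreover have "?\<rho> ` {1..t} \<in> nsets {1..n} t"
      unfolding image_nsets_iff[OF \<rho>] using assms by (auto simp: nsets_def)
    moreover have "?\<rho> ` {t + 1..t + d} \<in> nsets {1..n} d"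
      unfolding image_nsets_iff[OF \<rho>] using assms by (auto simp: nsets_def)
    then have V: "?\<rho> ` {t + 1..t + d} \<subseteq> {1..n}" "card (?\<rho> ` {t + 1..t + d}) = d"
      unfolding nsets_def by simp_all
    have "?\<rho> ` {1..t} \<inter> ?\<rho> ` {t + 1..t + d} = {}"
      by (simp flip: image_Int[OF i])
    then have "?\<rho> ` {t + 1..t + d} \<subseteq> {1..n} - ?\<rho> ` {1..t}" using V(1) by blast
    ultimately show ?R using V(2) by blast
  }
  assume ?R
  then obtain X V where X: "X \<in> nsets {1..n} t" and V: "V \<subseteq> {1..n} - X" "card V = d"
    and \<F>: "\<F> = family_L n k X (X \<union> V) (X \<union> V)" by blast
  have "\<exists>\<pi>. \<pi> permutes {1..n} \<and> \<pi> ` X = {1..t} \<and> \<pi> ` V = {t + 1..t + d}"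
  proof (rule ex_permutes_image_pair)
    show "X \<subseteq> {1..n}" "card X = card {1..t}" using X by (simp_all add: nsets_def)
    show "V \<subseteq> {1..n}" "X \<inter> V = {}" "card V = card {t + 1..t + d}" using V by auto
    show "{1..t} \<subseteq> {1..n}" "{t + 1..t + d} \<subseteq> {1..n}" "{1..t} \<inter> {t + 1..t + d} = {}"
      using assms by auto
  qed simp
  then obtain \<pi> where \<pi>: "\<pi> permutes {1..n}" "\<pi> ` X = {1..t}" "\<pi> ` V = {t + 1..t + d}" by blast
  have "(\<lambda>F. \<pi> ` F) ` \<F> = canonical_L n k t d d"
    unfolding \<F> image_family_L[OF \<pi>(1)] canonical_L_def split image_Un \<pi>(2,3) ..
  then show ?L using \<pi>(1) by (auto simp: isomorphic_def)
qed

text \<open>For t \<le> n the maximum ranges over a nonempty set and is attained, and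
  \<open>card \<F> - card (containing \<F> X)\<close> is the size of the set difference.\<close>

lemma diversity_attained:
  assumes "finite \<F>" "t \<le> n"
  shows "\<exists>X\<in>nsets {1..n} t. diversity n t \<F> = card (\<F> - containing \<F> X)"
    and "X \<in> nsets {1..n} t \<Longrightarrow> diversity n t \<F> \<le> card (\<F> - containing \<F> X)"
proof -
  let ?I = "(\<lambda>S. card (containing \<F> S)) ` nsets {1..n} t"
  have c: "card (\<F> - containing \<F> X) = card \<F> - card (containing \<F> X)" for X
    using assms(1) by (intro card_Diff_subset) (auto simp: containing_def intro: finite_subset)
  have fin: "finite ?I" by (simp add: finite_imp_finite_nsets)
  have "nsets {1..n} t \<noteq> {}" using assms(2) by (simp add: nsets_eq_empty_iff)
  then have "Max ?I \<in> ?I" using fin by (intro Max_in) auto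
  then show "\<exists>X\<in>nsets {1..n} t. diversity n t \<F> = card (\<F> - containing \<F> X)"
    unfolding diversity_def max_degree_def c by auto
  assume "X \<in> nsets {1..n} t"
  then have "card (containing \<F> X) \<le> Max ?I" using fin by (intro Max_ge) auto
  then show "diversity n t \<F> \<le> card (\<F> - containing \<F> X)"
    unfolding diversity_def max_degree_def c by (rule diff_le_mono2)
qed

theorem theorem1p14:
  fixes n k t d :: nat and \<F> :: "nat set set"
  assumes "k \<ge> t + 2" and "t + 2 \<ge> 4"
    and "n \<ge> 7 * (k - t + 1) * k ^ 2"
    and "d \<ge> 2"
    and "\<F> \<subseteq> nsets {1..n} k"
    and "t_intersecting t \<F>"
    and "int (card \<F>) \<ge>
           int (int_binom (int n - int t) (int k - int t))
           - int (int_binom (int n - int t - int d) (int k - int t))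
           + int t * int (int_binom (int n - int t - int d) (int k - int t - int d + 1))"
  shows "let B = t * int_binom (int n - int t - int d) (int k - int t - int d + 1) in
    (diversity n t \<F> \<le> B \<longleftrightarrow>
       (\<exists>X \<in> nsets {1..n} t. card (\<F> - containing \<F> X) \<le> B)) \<and>
    (diversity n t \<F> \<le> B \<or>
       d \<le> t + 2 \<and> (\<exists>Z \<in> nsets {1..n} (t + 2). \<F> \<subseteq> family_A n k t Z)) \<and>
    (2 \<le> d \<and> d \<le> k - t + 1 \<longrightarrow> diversity n t \<F> \<le> B \<longrightarrow>
       (diversity n t \<F> = B \<longleftrightarrow> isomorphic n \<F> (canonical_L n k t d d)))"
proof -
  interpret large_ground_set n k t using assms(1-3) by unfold_locales auto
  have fin: "finite \<F>" using assms(5) finite_subset finite_imp_finite_nsets by blast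
  have "int_binom (int n - int t) (int k - int t) = (n - t) choose (k - t)"
    using avoiding_eq[of 0] by simp
  then have "int (((n - t) choose (k - t)) + t * missing d) \<le> int (card \<F> + avoiding d)"
    using assms(7) by simp
  then have large: "large (card \<F>) d" by (simp only: of_nat_le_iff)
  note att = diversity_attained[OF fin nt(2)]
  have iff: "diversity n t \<F> \<le> t * missing d \<longleftrightarrow>
      (\<exists>X \<in> nsets {1..n} t. card (\<F> - containing \<F> X) \<le> t * missing d)"
  proof
    assume "diversity n t \<F> \<le> t * missing d"
    then show "\<exists>X\<in>nsets {1..n} t. card (\<F> - containing \<F> X) \<le> t * missing d"
      using att(1) by auto
  next
    assume "\<exists>X\<in>nsets {1..n} t. card (\<F> - containing \<F> X) \<le> t * missing d"
    then show "diversity n t \<F> \<le> t * missing d" using att(2) order_trans by blast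
  qed
  have dich: "diversity n t \<F> \<le> t * missing d \<or>
       d \<le> t + 2 \<and> (\<exists>Z \<in> nsets {1..n} (t + 2). \<F> \<subseteq> family_A n k t Z)"
    unfolding iff by (rule dichotomy[OF assms(5,6,4) large])
  have ext: "diversity n t \<F> = t * missing d \<longleftrightarrow> isomorphic n \<F> (canonical_L n k t d d)"
    if d: "d \<le> k - t + 1" and le: "diversity n t \<F> \<le> t * missing d"
  proof -
    have "t + d \<le> n" using d nt(3) k by linarith
    note iso = isomorphic_canonical_L_iff[OF this, of \<F> k]
    show ?thesis
    proof
      assume eq: "diversity n t \<F> = t * missing d"
      then obtain X where X: "X \<in> nsets {1..n} t" "card (\<F> - containing \<F> X) = t * missing d"
        using att(1) by auto
      show "isomorphic n \<F> (canonical_L n k t d d)"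
        unfolding iso using extremal_family[OF assms(5,6) X(1) _ d large X(2)] X(1) assms(4) by auto
    next
      assume "isomorphic n \<F> (canonical_L n k t d d)"
      then obtain X V where XV: "X \<in> nsets {1..n} t" "V \<subseteq> {1..n} - X" "card V = d"
        and \<F>: "\<F> = family_L n k X (X \<union> V) (X \<union> V)" unfolding iso by blast
      obtain S where S: "S \<in> nsets {1..n} t" "diversity n t \<F> = card (\<F> - containing \<F> S)"
        using att(1) by blast
      \<comment> \<open>\<open>S\<close> attains the maximum degree. Against the size hypothesis,
        this bound leaves at least \<open>t * missing d\<close> members not containing
        \<open>S\<close>; \<open>le\<close> gives the other inequality.\<close>
      have "card (containing \<F> S) + avoiding d \<le> (n - t) choose (k - t)"
        unfolding \<F> by (rule degree_family_L_le[OF XV assms(4) d S(1)])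
      moreover have "card \<F> \<le> card (containing \<F> S) + card (\<F> - containing \<F> S)"
        using card_Un_le[of "containing \<F> S" "\<F> - containing \<F> S"]
        by (metis Un_Diff_cancel Un_absorb1 containing_def mem_Collect_eq subsetI)
      ultimately have "t * missing d \<le> card (\<F> - containing \<F> S)" using large by linarith
      then show "diversity n t \<F> = t * missing d" using S(2) le by simp
    qed
  qed
  show ?thesis unfolding Let_def using iff dich ext by blast
qed

end
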